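(* Let $1\le p<\infty$, $t>-1$ and $N\in\mathbb{N}_0$. Then $$\|f\|_{p,t}\approx\|\rho^N\mathcal{L}_n^N f\|_{p,t}\approx\sum_{|\alpha|=N}\|\rho^{\langle\alpha\rangle}\mathcal{L}^{\alpha}f\|_{p,t}$$ as $f$ ranges over $A_t^p(\mathcal{U})$, where the sum is over $\alpha\in\mathbb{N}_0^n$ with $|\alpha|=N$. That is, any two of these three quantities are bounded by each other up to positive finite constants independent of $f\in A_t^p(\mathcal{U})$.
   Context: Let $n$ be a positive integer. $\mathbb{N}_0$ denotes the nonnegative integers. Write $z=(z',z_n)\in\mathbb{C}^n$ with $z'=(z_1,\dots,z_{n-1})\in\mathbb{C}^{n-1}$, $z_n\in\mathbb{C}$. The Siegel upper half-space is $\mathcal{U}=\{z\in\mathbb{C}^n:\mathrm{Im}\,z_n>|z'|^2\}$, and $\rho(z)=\mathrm{Im}\,z_n-|z'|^2$ for $z\in\mathcal{U}$. For $1\le p<\infty$ and $t>-1$, $L_t^p(\mathcal{U})$ is the space of Lebesgue measurable $f$ on $\mathcal{U}$ with $\|f\|_{p,t}=\left(\int_{\mathcal{U}}|f(z)|^p\rho(z)^t\,dV(z)\right)^{1/p}<\infty$, where $dV$ is Lebesgue measure on $\mathbb{C}^n$. The weighted Bergman space $A_t^p(\mathcal{U})$ is the subspace of holomorphic functions in $L_t^p(\mathcal{U})$. Differential operators: $\mathcal{L}_j=\frac{\partial}{\partial z_j}+2i\bar z_j\frac{\partial}{\partial z_n}$ for $1\le j\le n-1$, $\mathcal{L}_n=\frac{\partial}{\partial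 z_n}$, and $\mathcal{L}^{\alpha}=(\mathcal{L}_1)^{\alpha_1}\cdots(\mathcal{L}_n)^{\alpha_n}$ for $\alpha\in\mathbb{N}_0^n$. For $\alpha=(\alpha',\alpha_n)\in\mathbb{N}_0^n$ with $\alpha'\in\mathbb{N}_0^{n-1}$, $|\alpha|=\alpha_1+\dots+\alpha_n$, $|\alpha'|=\alpha_1+\dots+\alpha_{n-1}$ and $\langle\alpha\rangle=|\alpha'|/2+\alpha_n$. *)

theory Defs
  imports "HOL-Analysis.Analysis"
begin

text \<open>
  Points of $\mathbb{C}^n$ are vectors of type \<open>complex ^ 'n\<close> over a finite linearly ordered index
  type with \<open>n = CARD('n)\<close>; the distinguished last coordinate is the one at the greatest index.
  The case \<open>n = 1\<close> is included, and then there are no coordinates \<open>z'\<close>.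
\<close>

abbreviation last_index :: "'n::{finite,linorder}" where
  "last_index \<equiv> Max UNIV"

definition siegel_rho :: "complex ^ 'n::{finite,linorder} \<Rightarrow> real" where
  "siegel_rho z = Im (z $ last_index) - (\<Sum>j\<in>UNIV - {last_index}. (cmod (z $ j))\<^sup>2)"

definition siegel_domain :: "(complex ^ 'n::{finite,linorder}) set" where
  "siegel_domain = {z. Im (z $ last_index) > (\<Sum>j\<in>UNIV - {last_index}. (cmod (z $ j))\<^sup>2)}"

text \<open>
  Holomorphy in several variables: the real Frechet derivative exists and is complex linear.
  Intended for open \<open>S\<close>.
\<close>

definition holomorphic_several_on :: "(complex ^ 'n \<Rightarrow> complex) \<Rightarrow> (complex ^ 'n) set \<Rightarrow> bool" where
  "holomorphic_several_on f S \<longleftrightarrow>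
     (\<forall>z\<in>S. \<exists>a::complex ^ 'n. (f has_derivative (\<lambda>h. \<Sum>j\<in>UNIV. a $ j * h $ j)) (at z))"

text \<open>
  The Wirtinger derivative \<open>\<partial>f/\<partial>z\<^sub>j = (\<partial>f/\<partial>x\<^sub>j - \<i> \<partial>f/\<partial>y\<^sub>j) / 2\<close>, where \<open>z\<^sub>j = x\<^sub>j + \<i> y\<^sub>j\<close>. This general
  form is needed because \<open>\<L>\<^sub>j f\<close> is in general not holomorphic even if \<open>f\<close> is.
\<close>

definition wirtinger_deriv ::
  "'n::finite \<Rightarrow> (complex ^ 'n \<Rightarrow> complex) \<Rightarrow> complex ^ 'n \<Rightarrow> complex" where
  "wirtinger_deriv j f z =
     (vector_derivative (\<lambda>s::real. f (z + s *\<^sub>R axis j 1)) (at 0)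
      - \<i> * vector_derivative (\<lambda>s::real. f (z + s *\<^sub>R axis j \<i>)) (at 0)) / 2"

definition siegel_L ::
  "'n::{finite,linorder} \<Rightarrow> (complex ^ 'n::{finite,linorder} \<Rightarrow> complex) \<Rightarrow>
     complex ^ 'n::{finite,linorder} \<Rightarrow> complex" where
  "siegel_L j f z =
     (if j = last_index then wirtinger_deriv last_index f z
      else wirtinger_deriv j f z + 2 * \<i> * cnj (z $ j) * wirtinger_deriv last_index f z)"

text \<open>
  The product is taken in increasing order of the indices, the last factor being applied first.
\<close>

definition siegel_L_multi ::
  "('n::{finite,linorder} \<Rightarrow> nat) \<Rightarrow> (complex ^ 'n::{finite,linorder} \<Rightarrow> complex) \<Rightarrow>
     complex ^ 'n::{finite,linorder} \<Rightarrow> complex" where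
  "siegel_L_multi \<alpha> f = foldr (\<lambda>j. siegel_L j ^^ \<alpha> j) (sorted_list_of_set UNIV) f"

definition multi_order :: "('n::{finite,linorder} \<Rightarrow> nat) \<Rightarrow> nat" where
  "multi_order \<alpha> = (\<Sum>j\<in>UNIV. \<alpha> j)"

definition multi_weight :: "('n::{finite,linorder} \<Rightarrow> nat) \<Rightarrow> real" where
  "multi_weight \<alpha> = real (\<Sum>j\<in>UNIV - {last_index}. \<alpha> j) / 2 + real (\<alpha> last_index)"

lemma finite_multi_order_eq: "finite {\<alpha> :: 'n::{finite,linorder} \<Rightarrow> nat. multi_order \<alpha> = N}"
proof (rule finite_subset)
  show "{\<alpha> :: 'n \<Rightarrow> nat. multi_order \<alpha> = N} \<subseteq> PiE UNIV (\<lambda>_. {..N})"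
    by (auto simp: multi_order_def PiE_def intro!: member_le_sum)
  show "finite (PiE (UNIV :: 'n set) (\<lambda>_. {..N}))"
    by (intro finite_PiE) auto
qed

text \<open>
  The norm takes values in \<open>[0, \<infinity>]\<close>, so that an estimate by a finite quantity also asserts that
  the estimated integral converges.
\<close>

definition siegel_norm ::
  "real \<Rightarrow> real \<Rightarrow> (complex ^ 'n::{finite,linorder} \<Rightarrow> complex) \<Rightarrow> ennreal" where
  "siegel_norm p t f =
     (let I = (\<integral>\<^sup>+ z. ennreal (cmod (f z) powr p * siegel_rho z powr t)
                 \<partial>lebesgue_on siegel_domain)
      in if I = \<infinity> then \<infinity> else ennreal (enn2real I powr (1 / p)))"

text \<open>Functions on the half-space are total functions whose values elsewhere are ignored.\<close>

definition siegel_Lp :: "real \<Rightarrow> real \<Rightarrow> (complex ^ 'n::{finite,linorder} \<Rightarrow> complex) set" where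
  "siegel_Lp p t =
     {f. f \<in> borel_measurable (lebesgue_on siegel_domain) \<and> siegel_norm p t f < \<infinity>}"

definition siegel_bergman ::
  "real \<Rightarrow> real \<Rightarrow> (complex ^ 'n::{finite,linorder} \<Rightarrow> complex) set" where
  "siegel_bergman p t = {f \<in> siegel_Lp p t. holomorphic_several_on f siegel_domain}"

definition comparable_on :: "'a set \<Rightarrow> ('a \<Rightarrow> ennreal) \<Rightarrow> ('a \<Rightarrow> ennreal) \<Rightarrow> bool" where
  "comparable_on A F G \<longleftrightarrow>
     (\<exists>c C :: real. c > 0 \<and> C > 0 \<and>
        (\<forall>f\<in>A. F f \<le> ennreal C * G f \<and> G f \<le> ennreal c * F f))"

end

theory Submission
  imports Defs "HOL-Complex_Analysis.Cauchy_Integral_Formula"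
begin

text \<open>
  Write \<open>F\<close>, \<open>G\<close>, \<open>H\<close> for the three quantities, in the order of the statement. The multi-index
  \<open>(0, \<dots>, 0, N)\<close> gives \<open>G \<le> H\<close>, so it suffices to bound \<open>H\<close> by \<open>F\<close> and \<open>F\<close> by \<open>G\<close>. Both bounds are
  proved for the integrals \<open>\<integral> |f|\<^sup>p \<rho>\<^sup>s\<close> with an arbitrary real exponent \<open>s\<close> (for the second one,
  \<open>s > -1\<close>), since a factor \<open>\<rho>\<^sup>k\<close> inside the norm only shifts \<open>s\<close> by \<open>p k\<close>; this makes it possible to apply
  one operator at a time.

  \<^bold>\<open>Bound of \<open>H\<close> by \<open>F\<close>.\<close> Let \<open>v\<^sub>j(w) = e\<^sub>j + 2 \<i> cnj(w\<^sub>j) e\<^sub>n\<close> for \<open>j < n\<close> and \<open>v\<^sub>n(w) = e\<^sub>n\<close>. The coefficient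
  \<open>2 \<i> cnj(w\<^sub>j)\<close> of \<open>\<L>\<^sub>j\<close> is antiholomorphic, hence a constant for Wirtinger derivatives, and so
  \<open>\<L>\<^sub>j\<^sup>a g (w)\<close> is the \<open>a\<close>-th complex derivative at \<open>\<zeta> = 0\<close> of the slice \<open>\<zeta> \<mapsto> g(w + \<zeta> v\<^sub>j(w))\<close>. This slice
  is holomorphic not only for holomorphic \<open>g\<close> but also for the functions that arise when the operators
  with other indices have already been applied; these are sums of holomorphic functions multiplied by
  monomials in the conjugates of the other coordinates (\<open>conj_holomorphic\<close>). Moreover
  \<open>\<rho>(w + \<zeta> v\<^sub>j(w))\<close> is \<open>\<rho>(w) - |\<zeta>|\<^sup>2\<close> for \<open>j < n\<close> and \<open>\<rho>(w) + Im \<zeta>\<close> for \<open>j = n\<close>, so a disc of radius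
  comparable to \<open>R = \<rho>(w)\<^sup>1\<^sup>/\<^sup>2\<close>, respectively \<open>R = \<rho>(w)\<close>, stays in the domain and \<open>\<rho>\<close> is nearly constant on
  it. Cauchy's formula on the circles of radius \<open>r\<close> between \<open>R/4\<close> and \<open>R/2\<close> and Jensen's inequality bound
  \<open>R\<^sup>a\<^sup>p |\<L>\<^sub>j\<^sup>a g (w)|\<^sup>p\<close> by an average of \<open>|g|\<^sup>p\<close> over points \<open>w + \<zeta> v\<^sub>j(w)\<close>. For a fixed \<open>\<zeta>\<close> the map
  \<open>w \<mapsto> w + \<zeta> v\<^sub>j(w)\<close> is a shear followed by a translation, which preserves volume; exchanging the integrals over \<open>w\<close> and \<open>\<zeta>\<close>
  therefore gives the bound, with the exact power of \<open>\<rho>\<close> that \<open>\<langle>\<alpha>\<rangle>\<close> prescribes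
  (\<open>siegel_L_power_integral_bound\<close>).

  \<^bold>\<open>Bound of \<open>F\<close> by \<open>G\<close>.\<close> The map \<open>\<delta>\<^sub>c(z) = z + \<i> (c - 1) \<rho>(z) e\<^sub>n\<close> multiplies both \<open>\<rho>\<close> and volume by \<open>c\<close>, so
  the integral of \<open>|g \<circ> \<delta>\<^sub>2|\<^sup>p \<rho>\<^sup>s\<close> is that of \<open>|g|\<^sup>p \<rho>\<^sup>s\<close> times \<open>2\<^sup>-\<^sup>(\<^sup>s\<^sup>+\<^sup>1\<^sup>)\<close>, a factor smaller than 1. The
  difference \<open>g - g \<circ> \<delta>\<^sub>2\<close> is an integral of \<open>\<rho> \<L>\<^sub>n g\<close> along the segment from \<open>z\<close> to \<open>\<delta>\<^sub>2(z)\<close>, hence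
  controlled by the integral of \<open>|\<rho> \<L>\<^sub>n g|\<^sup>p \<rho>\<^sup>s\<close>, and the term with \<open>g \<circ> \<delta>\<^sub>2\<close> can be absorbed because
  \<open>\<integral> |g|\<^sup>p \<rho>\<^sup>s\<close> is finite (\<open>bergman_integral_le_siegel_L_last\<close>). For \<open>g = \<L>\<^sub>n\<^sup>k f\<close> that finiteness is an
  instance of the first bound, which permits the iteration up to order \<open>N\<close>.
\<close>

section \<open>Holomorphic functions of several variables\<close>

text \<open>
  Cauchy's formula for the higher derivatives, with the contour integral written out over \<open>{0..1}\<close>, so
  that Jensen's inequality and differentiation under the integral sign apply to it.
\<close>

lemma deriv_circle_average:
  fixes h :: "complex \<Rightarrow> complex" and r R :: real
  assumes h: "h holomorphic_on ball 0 R" and r: "0 < r" "r < R"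
  shows "(deriv ^^ a) h 0 * r ^ a =
           fact a * integral {0..1} (\<lambda>t. h (r * cis (2 * pi * t)) * cis (- (2 * pi * t)) ^ a)"
proof -
  have sub: "cball 0 r \<subseteq> ball (0::complex) R" "ball 0 r \<subseteq> ball (0::complex) R"
    using r by auto
  have c: "continuous_on (cball 0 r) h" "h holomorphic_on ball 0 r"
    using h sub holomorphic_on_imp_continuous_on holomorphic_on_subset continuous_on_subset by blast+
  have "(deriv ^^ a) h 0 = (fact a) / (2 * pi * \<i>) *
          contour_integral (circlepath 0 r) (\<lambda>u. h u / (u - 0) ^ (Suc a))"
    using Cauchy_higher_derivative_integral_circlepath(2)[OF c, of 0 a] r by simp
  also have "contour_integral (circlepath 0 r) (\<lambda>u. h u / (u - 0) ^ (Suc a))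
     = integral {0..1} (\<lambda>t. (2 * pi * \<i> / r ^ a) * (h (r * cis (2 * pi * t)) * cis (- (2 * pi * t)) ^ a))"
    unfolding contour_integral_integral
  proof (rule integral_cong)
    fix t :: real assume t: "t \<in> {0..1}"
    have e: "exp (2 * of_real pi * \<i> * of_real t) = cis (2 * pi * t)"
      by (simp add: cis_conv_exp mult_ac)
    have i: "cis (- (2 * pi * t)) = 1 / cis (2 * pi * t)"
      by (simp add: cis_inverse[symmetric] field_simps)
    have d: "vector_derivative (circlepath 0 r) (at t) = 2 * pi * \<i> * r * cis (2 * pi * t)"
      by (simp only: vector_derivative_circlepath e)
    show "h (circlepath 0 r t) / (circlepath 0 r t - 0) ^ Suc a * vector_derivative (circlepath 0 r) (at t)
       = (2 * pi * \<i> / r ^ a) * (h (r * cis (2 * pi * t)) * cis (- (2 * pi * t)) ^ a)"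
      using r unfolding d unfolding circlepath e i
      by (simp add: field_simps power_mult_distrib)
  qed
  finally show ?thesis using r by (simp add: field_simps)
qed

lemma bounded_linear_scale_vec: "bounded_linear (\<lambda>h::complex. h *s (v :: complex ^ 'n))"
  by (simp add: linear_conv_bounded_linear[symmetric] linear_iff vec_eq_iff algebra_simps)

text \<open>
  A slice in a direction \<open>v\<close> is complex differentiable as soon as the antilinear part of the derivative
  vanishes in the coordinates in which \<open>v\<close> moves; the function itself may fail to be holomorphic.
\<close>

lemma has_derivative_slice:
  fixes g :: "complex ^ 'n \<Rightarrow> complex"
  assumes g: "(g has_derivative (\<lambda>h. \<Sum>j\<in>UNIV. a $ j * h $ j + b $ j * cnj (h $ j))) (at (w + \<zeta> *s v))"
    and v: "\<And>j. b $ j = 0 \<or> v $ j = 0"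
  shows "((\<lambda>\<zeta>. g (w + \<zeta> *s v)) has_field_derivative (\<Sum>j\<in>UNIV. v $ j * a $ j)) (at \<zeta>)"
proof -
  have 1: "((\<lambda>\<zeta>. w + \<zeta> *s v) has_derivative (\<lambda>h. h *s v)) (at \<zeta>)"
    using has_derivative_add[OF has_derivative_const bounded_linear_imp_has_derivative[OF bounded_linear_scale_vec]]
    by simp
  have "((\<lambda>\<zeta>. g (w + \<zeta> *s v)) has_derivative
      (\<lambda>h. \<Sum>j\<in>UNIV. a $ j * (h *s v) $ j + b $ j * cnj ((h *s v) $ j))) (at \<zeta>)"
    by (rule has_derivative_compose[OF 1 g])
  also have "(\<lambda>h. \<Sum>j\<in>UNIV. a $ j * (h *s v) $ j + b $ j * cnj ((h *s v) $ j)) =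
      (*) (\<Sum>j\<in>UNIV. v $ j * a $ j)"
  proof
    fix h
    have "a $ j * (h *s v) $ j + b $ j * cnj ((h *s v) $ j) = h * (v $ j * a $ j)" for j
      using v[of j] by auto
    then show "(\<Sum>j\<in>UNIV. a $ j * (h *s v) $ j + b $ j * cnj ((h *s v) $ j)) =
      (\<Sum>j\<in>UNIV. v $ j * a $ j) * h"
      unfolding sum_distrib_right by (intro sum.cong refl) (simp only: mult.commute[of h])
  qed
  finally show ?thesis by (simp add: has_field_derivative_def)
qed

lemma wirtinger_deriv_eq:
  fixes g :: "complex ^ 'n \<Rightarrow> complex"
  assumes g: "(g has_derivative (\<lambda>h. \<Sum>j\<in>UNIV. a $ j * h $ j + b $ j * cnj (h $ j))) (at z)"
  shows "wirtinger_deriv j g z = a $ j"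
proof -
  have *: "vector_derivative (\<lambda>s::real. g (z + s *\<^sub>R axis j c)) (at 0) = a $ j * c + b $ j * cnj c" for c
  proof (rule vector_derivative_at)
    have 1: "((\<lambda>s::real. z + s *\<^sub>R axis j c) has_derivative (\<lambda>h. h *\<^sub>R axis j c)) (at 0)"
      by (auto intro!: derivative_eq_intros)
    have "((\<lambda>s::real. g (z + s *\<^sub>R axis j c)) has_derivative
      (\<lambda>h. \<Sum>k\<in>UNIV. a $ k * (h *\<^sub>R axis j c) $ k + b $ k * cnj ((h *\<^sub>R axis j c) $ k))) (at 0)"
      by (rule has_derivative_compose[OF 1]) (use g in simp)
    also have "(\<lambda>h. \<Sum>k\<in>UNIV. a $ k * (h *\<^sub>R axis j c) $ k + b $ k * cnj ((h *\<^sub>R axis j c) $ k)) =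
       (\<lambda>h. h *\<^sub>R (a $ j * c + b $ j * cnj c))"
    proof
      fix h :: real
      have "(\<Sum>k\<in>UNIV. a $ k * (h *\<^sub>R axis j c) $ k + b $ k * cnj ((h *\<^sub>R axis j c) $ k))
        = (\<Sum>k\<in>UNIV. if k = j then h *\<^sub>R (a $ j * c + b $ j * cnj c) else 0)"
        by (intro sum.cong refl) (auto simp: axis_def algebra_simps)
      then show "(\<Sum>k\<in>UNIV. a $ k * (h *\<^sub>R axis j c) $ k + b $ k * cnj ((h *\<^sub>R axis j c) $ k))
        = h *\<^sub>R (a $ j * c + b $ j * cnj c)" by simp
    qed
    finally show "((\<lambda>s::real. g (z + s *\<^sub>R axis j c)) has_vector_derivative a $ j * c + b $ j * cnj c) (at 0)"
      by (simp add: has_vector_derivative_def)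
  qed
  show ?thesis unfolding wirtinger_deriv_def * by (simp add: algebra_simps)
qed

lemma wirtinger_deriv_cong:
  fixes g :: "complex ^ 'n \<Rightarrow> complex"
  assumes "open D" "z \<in> D" "\<And>x. x \<in> D \<Longrightarrow> g x = h x"
  shows "wirtinger_deriv j g z = wirtinger_deriv j h z"
proof -
  have "vector_derivative (\<lambda>s::real. g (z + s *\<^sub>R axis j c)) (at 0) =
        vector_derivative (\<lambda>s::real. h (z + s *\<^sub>R axis j c)) (at 0)" for c
  proof (rule vector_derivative_cong_eq)
    have "((\<lambda>s::real. z + s *\<^sub>R axis j c) \<longlongrightarrow> z) (nhds 0)"
      by (auto intro!: tendsto_eq_intros filterlim_ident)
    then have "\<forall>\<^sub>F s in nhds 0. z + s *\<^sub>R axis j c \<in> D"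
      using assms(1,2) by (simp add: tendsto_def)
    then show "\<forall>\<^sub>F s in nhds 0. s \<in> UNIV \<longrightarrow> g (z + s *\<^sub>R axis j c) = h (z + s *\<^sub>R axis j c)"
      by eventually_elim (use assms(3) in auto)
  qed auto
  then show ?thesis unfolding wirtinger_deriv_def by simp
qed

lemma holomorphic_several_gradient:
  assumes "holomorphic_several_on f D" "z \<in> D"
  shows "(f has_derivative (\<lambda>h. \<Sum>j\<in>UNIV. wirtinger_deriv j f z * h $ j)) (at z)"
proof -
  obtain a where a: "(f has_derivative (\<lambda>h. \<Sum>j\<in>UNIV. a $ j * h $ j)) (at z)"
    using assms unfolding holomorphic_several_on_def by blast
  then have "(f has_derivative (\<lambda>h. \<Sum>j\<in>UNIV. a $ j * h $ j + 0 $ j * cnj (h $ j))) (at z)" by simp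
  then have "wirtinger_deriv j f z = a $ j" for j by (rule wirtinger_deriv_eq)
  with a show ?thesis by simp
qed

lemma holomorphic_several_axis_slice:
  fixes f :: "complex ^ 'n \<Rightarrow> complex"
  assumes f: "holomorphic_several_on f D" and "z + \<zeta> *s axis j 1 \<in> D"
  shows "((\<lambda>\<zeta>. f (z + \<zeta> *s axis j 1)) has_field_derivative wirtinger_deriv j f (z + \<zeta> *s axis j 1)) (at \<zeta>)"
proof -
  have "(f has_derivative (\<lambda>h. \<Sum>k\<in>UNIV. (\<chi> k. wirtinger_deriv k f (z + \<zeta> *s axis j 1)) $ k * h $ k + 0 $ k * cnj (h $ k))) (at (z + \<zeta> *s axis j 1))"
    using holomorphic_several_gradient[OF assms] by simp
  from has_derivative_slice[OF this]
  have "((\<lambda>\<zeta>. f (z + \<zeta> *s axis j 1)) has_field_derivative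
     (\<Sum>k\<in>UNIV. axis j 1 $ k * wirtinger_deriv k f (z + \<zeta> *s axis j 1))) (at \<zeta>)" by simp
  also have "(\<Sum>k\<in>UNIV. axis j 1 $ k * wirtinger_deriv k f (z + \<zeta> *s axis j 1)) =
    (\<Sum>k\<in>UNIV. if k = j then wirtinger_deriv k f (z + \<zeta> *s axis j 1) else 0)"
    by (intro sum.cong) (auto simp: axis_def)
  finally show ?thesis by simp
qed

lemma dist_axis_scale: "dist (z + \<zeta> *s axis j 1) z = cmod \<zeta>" for z :: "complex ^ 'n"
proof -
  have "\<zeta> *s axis j (1::complex) = axis j \<zeta>" by (simp add: vec_eq_iff axis_def)
  moreover have "norm (axis j \<zeta> :: complex ^ 'n) = cmod \<zeta>"
    by (simp add: norm_vec_def L2_set_def axis_def if_distrib[of norm] if_distrib[of "\<lambda>x. x\<^sup>2"]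
        cong: if_cong)
  ultimately show ?thesis by (simp add: dist_norm)
qed

lemma holomorphic_several_cauchy:
  fixes f :: "complex ^ 'n \<Rightarrow> complex" and r R :: real
  assumes f: "holomorphic_several_on f D" and r: "0 < r" "r < R" and sub: "ball z R \<subseteq> D"
  shows "wirtinger_deriv j f z =
     integral {0..1} (\<lambda>t. f (z + (r * cis (2 * pi * t)) *s axis j 1) * (cis (- (2 * pi * t)) / r))"
proof -
  have *: "((\<lambda>\<zeta>. f (z + \<zeta> *s axis j 1)) has_field_derivative wirtinger_deriv j f (z + \<zeta> *s axis j 1)) (at \<zeta>)"
    if "cmod \<zeta> < R" for \<zeta>
    using that by (intro holomorphic_several_axis_slice[OF f] subsetD[OF sub])
      (simp add: dist_axis_scale dist_commute[of z])
  have h: "(\<lambda>\<zeta>. f (z + \<zeta> *s axis j 1)) holomorphic_on ball 0 R"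
    by (rule holomorphic_onI)
      (use * in \<open>auto simp: field_differentiable_def intro: has_field_derivative_at_within\<close>)
  have "deriv (\<lambda>\<zeta>. f (z + \<zeta> *s axis j 1)) 0 = wirtinger_deriv j f (z + 0 *s axis j 1)"
    using r by (intro DERIV_imp_deriv *) auto
  with deriv_circle_average[OF h r, of 1] r show ?thesis
    by (simp add: field_simps)
qed

lemma holomorphic_several_continuous_on:
  assumes "holomorphic_several_on f D"
  shows "continuous_on D f"
  using holomorphic_several_gradient[OF assms]
  by (intro continuous_at_imp_continuous_on ballI has_derivative_continuous) blast

lemma continuous_on_section:
  assumes "continuous_on (A \<times> B) (\<lambda>(x, t). F x t)" "x \<in> A"
  shows "continuous_on B (F x)"
proof -
  have "continuous_on B (\<lambda>t. case (x, t) of (x, t) \<Rightarrow> F x t)"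
    by (rule continuous_on_compose2[OF assms(1) continuous_on_Pair[OF continuous_on_const continuous_on_id]])
      (use assms(2) in auto)
  then show ?thesis by simp
qed

lemma continuous_on_circle_shift:
  "continuous_on A (\<lambda>(x :: complex ^ 'n, t). x + (complex_of_real r * cis (2 * pi * t)) *s axis j 1)"
  unfolding case_prod_beta
  by (intro continuous_on_add continuous_on_fst continuous_on_id
      bounded_linear.continuous_on[OF bounded_linear_scale_vec] continuous_intros)

lemma circle_shift_in_ball:
  assumes "x \<in> ball z R" "0 \<le> r" "r < R" "ball z (2 * R) \<subseteq> D"
  shows "x + (complex_of_real r * cis (2 * pi * t)) *s axis j 1 \<in> D"
proof (rule subsetD[OF assms(4)])
  have "dist (x + (complex_of_real r * cis (2 * pi * t)) *s axis j 1) x = r"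
    using assms by (simp add: dist_axis_scale norm_mult)
  then show "x + (complex_of_real r * cis (2 * pi * t)) *s axis j 1 \<in> ball z (2 * R)"
    using assms dist_triangle[of "x + (complex_of_real r * cis (2 * pi * t)) *s axis j 1" z x]
    by (simp add: dist_commute)
qed

lemma continuous_on_circle_integrand:
  fixes g :: "complex ^ 'n \<Rightarrow> complex"
  assumes "continuous_on D g" "0 < r" "r < R" "ball z (2 * R) \<subseteq> D"
  shows "continuous_on (ball z R \<times> cbox 0 1)
     (\<lambda>(x, t). g (x + (complex_of_real r * cis (2 * pi * t)) *s axis j 1) * (cis (- (2 * pi * t)) / r))"
  unfolding case_prod_beta
proof (intro continuous_on_mult)
  show "continuous_on (ball z R \<times> cbox 0 1)
     (\<lambda>p. g (fst p + (complex_of_real r * cis (2 * pi * snd p)) *s axis j 1))"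
  proof (rule continuous_on_compose2[OF assms(1)])
    show "continuous_on (ball z R \<times> cbox 0 1)
     (\<lambda>p. fst p + (complex_of_real r * cis (2 * pi * snd p)) *s axis j 1)"
      using continuous_on_circle_shift unfolding case_prod_beta .
    show "(\<lambda>p. fst p + (complex_of_real r * cis (2 * pi * snd p)) *s axis j 1) ` (ball z R \<times> cbox 0 1) \<subseteq> D"
      using circle_shift_in_ball[OF _ _ assms(3,4)] assms(2) by auto
  qed
qed (use assms(2) in \<open>auto intro!: continuous_intros\<close>)

lemma continuous_on_wirtinger_deriv:
  fixes f :: "complex ^ 'n \<Rightarrow> complex"
  assumes D: "open D" and f: "holomorphic_several_on f D"
  shows "continuous_on D (wirtinger_deriv j f)"
proof (rule continuous_at_imp_continuous_on, rule ballI)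
  fix z assume "z \<in> D"
  then obtain e where e: "e > 0" "ball z e \<subseteq> D" using D open_contains_ball by blast
  define R r where "R = e / 2" and "r = e / 4"
  have R: "0 < r" "r < R" "ball z (2 * R) \<subseteq> D" "R > 0" using e by (auto simp: R_def r_def)
  have "continuous_on (ball z R) (\<lambda>x. integral (cbox 0 1) (\<lambda>t.
     f (x + (complex_of_real r * cis (2 * pi * t)) *s axis j 1) * (cis (- (2 * pi * t)) / r)))"
    by (rule integral_continuous_on_param,
        rule continuous_on_circle_integrand[OF holomorphic_several_continuous_on[OF f] R(1-3)])
  also have "?this \<longleftrightarrow> continuous_on (ball z R) (wirtinger_deriv j f)"
  proof (intro continuous_on_cong refl)
    fix x assume x: "x \<in> ball z R"
    have "ball x R \<subseteq> ball z (2 * R)"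
      using x by (auto simp: dist_commute) (smt (verit) dist_triangle dist_commute)
    then show "integral (cbox 0 1) (\<lambda>t. f (x + (complex_of_real r * cis (2 * pi * t)) *s axis j 1) *
        (cis (- (2 * pi * t)) / r)) = wirtinger_deriv j f x"
      using holomorphic_several_cauchy[OF f R(1,2), of x j] R(3) by auto
  qed
  finally show "isCont (wirtinger_deriv j f) z"
    using R(4) by (simp add: continuous_on_eq_continuous_at)
qed

text \<open>
  Differentiation under the integral sign in Cauchy's formula for the partial derivative. The gradient
  found in this way is complex linear, so partial derivatives of holomorphic functions are holomorphic;
  and its \<open>k\<close>-th entry is Cauchy's integral for the \<open>k\<close>-th partial derivative, so partial derivatives
  commute. The continuity of the partial derivatives, which the differentiation requires, also comes from
  Cauchy's formula.
\<close>

lemma wirtinger_deriv_circle_gradient: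
  fixes f :: "complex ^ 'n \<Rightarrow> complex"
  assumes D: "open D" and f: "holomorphic_several_on f D"
    and r: "0 < r" "r < R" and sub: "ball z (2 * R) \<subseteq> D"
  shows "(wirtinger_deriv j f has_derivative (\<lambda>h. \<Sum>k\<in>UNIV.
     integral {0..1} (\<lambda>t. wirtinger_deriv k f (z + (complex_of_real r * cis (2 * pi * t)) *s axis j 1) *
        (cis (- (2 * pi * t)) / r)) * h $ k)) (at z)"
proof -
  define sh where "sh = (\<lambda>(x :: complex ^ 'n) t. x + (complex_of_real r * cis (2 * pi * t)) *s axis j 1)"
  define c where "c = (\<lambda>t::real. cis (- (2 * pi * t)) / r)"
  define W where "W = (\<lambda>x t. \<chi> k. wirtinger_deriv k f (sh x t) * c t)"
  define fx where "fx = (\<lambda>x t. Blinfun (\<lambda>h. \<Sum>k\<in>UNIV. W x t $ k * h $ k))"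
  have bl: "bounded_linear (\<lambda>h. \<Sum>k\<in>UNIV. a $ k * h $ k)" for a :: "complex ^ 'n"
    by (intro bounded_linear_sum bounded_linear_mult_right[THEN bounded_linear_compose] bounded_linear_vec_nth)
  have fx: "blinfun_apply (fx x t) h = (\<Sum>k\<in>UNIV. W x t $ k * h $ k)" for x t h
    unfolding fx_def by (subst bounded_linear_Blinfun_apply) (auto intro: bl)
  have shD: "sh x t \<in> D" if "x \<in> ball z R" for x t
    unfolding sh_def using circle_shift_in_ball[OF that _ r(2) sub] r(1) by auto
  have contW: "continuous_on (ball z R \<times> cbox 0 1) (\<lambda>(x, t). W x t $ k)" for k
    using continuous_on_circle_integrand[OF continuous_on_wirtinger_deriv[OF D f, of k] r sub, of j]
    by (simp add: W_def sh_def c_def)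
  have contfx: "continuous_on (ball z R \<times> cbox 0 1) (\<lambda>(x, t). fx x t)"
  proof (rule continuous_on_blinfun_componentwise)
    fix i :: "complex ^ 'n"
    have "continuous_on (ball z R \<times> cbox 0 1) (\<lambda>p. W (fst p) (snd p) $ k)" for k
      using contW[of k] by (simp add: case_prod_beta)
    then show "continuous_on (ball z R \<times> cbox 0 1) (\<lambda>p. blinfun_apply (case p of (x, t) \<Rightarrow> fx x t) i)"
      unfolding case_prod_beta fx
      by (intro continuous_on_sum continuous_on_mult continuous_on_const)
  qed
  have zR: "z \<in> ball z R" using r by simp
  have "((\<lambda>x. integral (cbox 0 1) (\<lambda>t. f (sh x t) * c t)) has_derivative
       blinfun_apply (integral (cbox 0 1) (fx z))) (at z within ball z R)"
  proof (rule leibniz_rule[OF _ _ contfx zR convex_ball])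
    fix x and t :: real assume x: "x \<in> ball z R"
    have 1: "((\<lambda>x. sh x t) has_derivative (\<lambda>h. h)) (at x within ball z R)"
      unfolding sh_def by (auto intro!: derivative_eq_intros)
    have "((\<lambda>x. f (sh x t)) has_derivative (\<lambda>h. \<Sum>k\<in>UNIV. wirtinger_deriv k f (sh x t) * h $ k)) (at x within ball z R)"
      using has_derivative_compose[OF 1 holomorphic_several_gradient[OF f shD[OF x]]] .
    then have "((\<lambda>x. f (sh x t) * c t) has_derivative (\<lambda>h. (\<Sum>k\<in>UNIV. wirtinger_deriv k f (sh x t) * h $ k) * c t)) (at x within ball z R)"
      by (rule has_derivative_mult_left)
    also have "(\<lambda>h. (\<Sum>k\<in>UNIV. wirtinger_deriv k f (sh x t) * h $ k) * c t) = blinfun_apply (fx x t)"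
      by (rule ext) (simp add: fx W_def sum_distrib_right sum_distrib_left mult_ac)
    finally show "((\<lambda>x. f (sh x t) * c t) has_derivative blinfun_apply (fx x t)) (at x within ball z R)" .
  next
    fix x assume x: "x \<in> ball z R"
    have "continuous_on (cbox 0 1) (\<lambda>t. f (sh x t) * c t)"
      using continuous_on_section[OF continuous_on_circle_integrand[OF
          holomorphic_several_continuous_on[OF f] r sub] x] by (simp add: sh_def c_def)
    then show "(\<lambda>t. f (sh x t) * c t) integrable_on cbox 0 1"
      by (rule integrable_continuous)
  qed
  then have "((\<lambda>x. integral (cbox 0 1) (\<lambda>t. f (sh x t) * c t)) has_derivative
       blinfun_apply (integral (cbox 0 1) (fx z))) (at z)"
    by (simp only: at_within_open[OF zR open_ball])
  moreover have "blinfun_apply (integral (cbox 0 1) (fx z)) =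
      (\<lambda>h. \<Sum>k\<in>UNIV. integral (cbox 0 1) (\<lambda>t. W z t $ k) * h $ k)"
  proof
    fix h :: "complex ^ 'n"
    have iW: "(\<lambda>t. W z t $ k) integrable_on cbox 0 1" for k
      by (intro integrable_continuous continuous_on_section[OF contW zR])
    have "blinfun_apply (integral (cbox 0 1) (fx z)) h = integral (cbox 0 1) (\<lambda>t. fx z t h)"
      by (intro blinfun_apply_integral integrable_continuous continuous_on_section[OF contfx zR])
    also have "\<dots> = (\<Sum>k\<in>UNIV. integral (cbox 0 1) (\<lambda>t. W z t $ k * h $ k))"
      unfolding fx using iW by (intro integral_sum) (auto intro: integrable_on_mult_left)
    also have "\<dots> = (\<Sum>k\<in>UNIV. integral (cbox 0 1) (\<lambda>t. W z t $ k) * h $ k)"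
      by (simp add: integral_mult_left)
    finally show "blinfun_apply (integral (cbox 0 1) (fx z)) h =
      (\<Sum>k\<in>UNIV. integral (cbox 0 1) (\<lambda>t. W z t $ k) * h $ k)" .
  qed
  ultimately have "((\<lambda>x. integral (cbox 0 1) (\<lambda>t. f (sh x t) * c t)) has_derivative
       (\<lambda>h. \<Sum>k\<in>UNIV. integral (cbox 0 1) (\<lambda>t. W z t $ k) * h $ k)) (at z)" by simp
  then have "(wirtinger_deriv j f has_derivative
       (\<lambda>h. \<Sum>k\<in>UNIV. integral (cbox 0 1) (\<lambda>t. W z t $ k) * h $ k)) (at z)"
  proof (rule has_derivative_transform_within_open[OF _ open_ball zR])
    fix x assume x: "x \<in> ball z R"
    have "ball x R \<subseteq> ball z (2 * R)"
      using x by (auto simp: dist_commute) (smt (verit) dist_triangle dist_commute)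
    then show "integral (cbox 0 1) (\<lambda>t. f (sh x t) * c t) = wirtinger_deriv j f x"
      using holomorphic_several_cauchy[OF f r, of x j] sub by (auto simp: sh_def c_def)
  qed
  then show ?thesis by (simp add: W_def sh_def c_def)
qed

lemma open_circle_radii:
  fixes z :: "complex ^ 'n"
  assumes "open D" "z \<in> D"
  obtains r R :: real where "0 < r" "r < R" "ball z (2 * R) \<subseteq> D"
proof -
  obtain e where e: "e > 0" "ball z e \<subseteq> D" using assms open_contains_ball by blast
  then show ?thesis using that[of "e / 4" "e / 2"] by auto
qed

lemma holomorphic_several_wirtinger_deriv:
  fixes f :: "complex ^ 'n \<Rightarrow> complex"
  assumes D: "open D" and f: "holomorphic_several_on f D"
  shows "holomorphic_several_on (wirtinger_deriv j f) D"
  unfolding holomorphic_several_on_def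
proof
  fix z assume z: "z \<in> D"
  from open_circle_radii[OF D z] obtain r R where r: "0 < r" "r < R" "ball z (2 * R) \<subseteq> D" .
  show "\<exists>a. (wirtinger_deriv j f has_derivative (\<lambda>h. \<Sum>k\<in>UNIV. a $ k * h $ k)) (at z)"
    by (rule exI[of _ "\<chi> k. integral {0..1} (\<lambda>t. wirtinger_deriv k f (z + (complex_of_real r * cis (2 * pi * t)) *s axis j 1) *
        (cis (- (2 * pi * t)) / r))"])
      (unfold vec_lambda_beta, rule wirtinger_deriv_circle_gradient[OF D f r])
qed

lemma wirtinger_deriv_commute_holomorphic:
  fixes f :: "complex ^ 'n \<Rightarrow> complex"
  assumes D: "open D" and f: "holomorphic_several_on f D" and z: "z \<in> D"
  shows "wirtinger_deriv k (wirtinger_deriv j f) z = wirtinger_deriv j (wirtinger_deriv k f) z"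
proof -
  from open_circle_radii[OF D z] obtain r R where r: "0 < r" "r < R" "ball z (2 * R) \<subseteq> D" .
  define I where "I = (\<chi> k. integral {0..1} (\<lambda>t. wirtinger_deriv k f (z + (complex_of_real r * cis (2 * pi * t)) *s axis j 1) *
        (cis (- (2 * pi * t)) / r)))"
  have "(wirtinger_deriv j f has_derivative (\<lambda>h. \<Sum>k\<in>UNIV. I $ k * h $ k + 0 $ k * cnj (h $ k))) (at z)"
    unfolding I_def vec_lambda_beta zero_index mult_zero_left add_0_right
    by (rule wirtinger_deriv_circle_gradient[OF D f r])
  then have "wirtinger_deriv k (wirtinger_deriv j f) z = I $ k"
    by (rule wirtinger_deriv_eq)
  also have "ball z R \<subseteq> D" using subset_ball[of R "2 * R" z] r by simp
  then have "I $ k = wirtinger_deriv j (wirtinger_deriv k f) z"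
    unfolding I_def vec_lambda_beta
    by (rule holomorphic_several_cauchy[OF holomorphic_several_wirtinger_deriv[OF D f] r(1,2), symmetric])
  finally show ?thesis .
qed

section \<open>Holomorphic functions with antiholomorphic monomial coefficients\<close>

text \<open>
  A class closed under the operators \<open>\<L>\<^sub>j\<close> with \<open>j \<in> S\<close>: finite sums of holomorphic functions times
  monomials in \<open>cnj(z\<^sub>k)\<close>, \<open>k \<in> S\<close>. Values outside \<open>D\<close> are arbitrary, which is the purpose
  of the last rule.
\<close>

inductive conj_holomorphic ::
  "(complex ^ 'n::finite) set \<Rightarrow> 'n set \<Rightarrow> (complex ^ 'n \<Rightarrow> complex) \<Rightarrow> bool" for D S where
  holomorphic: "holomorphic_several_on f D \<Longrightarrow> conj_holomorphic D S f"
| mult_cnj: "conj_holomorphic D S g \<Longrightarrow> k \<in> S \<Longrightarrow> conj_holomorphic D S (\<lambda>z. cnj (z $ k) * g z)"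
| add: "conj_holomorphic D S g \<Longrightarrow> conj_holomorphic D S h \<Longrightarrow> conj_holomorphic D S (\<lambda>z. g z + h z)"
| cong: "conj_holomorphic D S g \<Longrightarrow> (\<And>z. z \<in> D \<Longrightarrow> h z = g z) \<Longrightarrow> conj_holomorphic D S h"

lemma conj_holomorphic_mono:
  assumes "conj_holomorphic D S g" "S \<subseteq> T"
  shows "conj_holomorphic D T g"
  using assms
  by (induction rule: conj_holomorphic.induct) (auto intro: conj_holomorphic.intros)

lemma conj_holomorphic_const_mult:
  assumes "conj_holomorphic D S g"
  shows "conj_holomorphic D S (\<lambda>z. c * g z)"
  using assms
proof (induction rule: conj_holomorphic.induct)
  case (holomorphic f)
  have "holomorphic_several_on (\<lambda>z. c * f z) D"
    unfolding holomorphic_several_on_def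
  proof
    fix z assume "z \<in> D"
    then obtain a where "(f has_derivative (\<lambda>h. \<Sum>j\<in>UNIV. a $ j * h $ j)) (at z)"
      using holomorphic unfolding holomorphic_several_on_def by blast
    from has_derivative_mult_right[OF this, of c]
    have "((\<lambda>z. c * f z) has_derivative (\<lambda>h. \<Sum>j\<in>UNIV. (\<chi> j. c * a $ j) $ j * h $ j)) (at z)"
      by (simp add: sum_distrib_left mult_ac)
    then show "\<exists>a. ((\<lambda>z. c * f z) has_derivative (\<lambda>h. \<Sum>j\<in>UNIV. a $ j * h $ j)) (at z)" by blast
  qed
  then show ?case by (rule conj_holomorphic.holomorphic)
next
  case (mult_cnj g k)
  from conj_holomorphic.mult_cnj[OF this(3,2)] show ?case by (simp add: mult_ac)
next
  case (add g h)
  from conj_holomorphic.add[OF this(3,4)] show ?case by (simp add: algebra_simps)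
next
  case (cong g h)
  from conj_holomorphic.cong[OF this(3), of "\<lambda>z. c * h z"] cong(2) show ?case by simp
qed

lemma conj_holomorphic_gradient:
  fixes g :: "complex ^ 'n \<Rightarrow> complex"
  assumes D: "open D" and z: "z \<in> D" and g: "conj_holomorphic D S g"
  shows "\<exists>b. (g has_derivative (\<lambda>h. \<Sum>j\<in>UNIV. (\<chi> j. wirtinger_deriv j g z) $ j * h $ j + b $ j * cnj (h $ j))) (at z)
    \<and> (\<forall>j. j \<notin> S \<longrightarrow> b $ j = 0)"
proof -
  have "\<exists>a b. (g has_derivative (\<lambda>h. \<Sum>j\<in>UNIV. a $ j * h $ j + b $ j * cnj (h $ j))) (at z)
      \<and> (\<forall>j. j \<notin> S \<longrightarrow> b $ j = 0)"
    using g
  proof (induction rule: conj_holomorphic.induct)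
    case (holomorphic f)
    then obtain a where "(f has_derivative (\<lambda>h. \<Sum>j\<in>UNIV. a $ j * h $ j)) (at z)"
      using z unfolding holomorphic_several_on_def by blast
    then show ?case by (intro exI[of _ a] exI[of _ 0]) simp
  next
    case (mult_cnj g k)
    then obtain a b where ab: "(g has_derivative (\<lambda>h. \<Sum>j\<in>UNIV. a $ j * h $ j + b $ j * cnj (h $ j))) (at z)"
      "\<forall>j. j \<notin> S \<longrightarrow> b $ j = 0" by blast
    have "((\<lambda>z. cnj (z $ k)) has_derivative (\<lambda>h. cnj (h $ k))) (at z)"
      by (intro bounded_linear_imp_has_derivative bounded_linear_compose[OF bounded_linear_cnj] bounded_linear_vec_nth)
    from has_derivative_mult[OF this ab(1)]
    have "((\<lambda>z. cnj (z $ k) * g z) has_derivative (\<lambda>h. cnj (z $ k) * (\<Sum>j\<in>UNIV. a $ j * h $ j + b $ j * cnj (h $ j)) + cnj (h $ k) * g z)) (at z)" .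
    also have "(\<lambda>h. cnj (z $ k) * (\<Sum>j\<in>UNIV. a $ j * h $ j + b $ j * cnj (h $ j)) + cnj (h $ k) * g z)
      = (\<lambda>h. \<Sum>j\<in>UNIV. (\<chi> j. cnj (z $ k) * a $ j) $ j * h $ j + (\<chi> j. cnj (z $ k) * b $ j + (if j = k then g z else 0)) $ j * cnj (h $ j))"
      by (rule ext) (simp add: sum_distrib_left sum.distrib algebra_simps if_distrib[of "\<lambda>x. _ * x"] cong: if_cong)
    finally show ?case using mult_cnj(2) ab(2)
      by (intro exI[of _ "\<chi> j. cnj (z $ k) * a $ j"]
          exI[of _ "\<chi> j. cnj (z $ k) * b $ j + (if j = k then g z else 0)"]) auto
  next
    case (add g h)
    then obtain a b a' b' where "(g has_derivative (\<lambda>h. \<Sum>j\<in>UNIV. a $ j * h $ j + b $ j * cnj (h $ j))) (at z)"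
      "\<forall>j. j \<notin> S \<longrightarrow> b $ j = 0" "(h has_derivative (\<lambda>h. \<Sum>j\<in>UNIV. a' $ j * h $ j + b' $ j * cnj (h $ j))) (at z)"
      "\<forall>j. j \<notin> S \<longrightarrow> b' $ j = 0" by blast
    with has_derivative_add[OF this(1,3)] show ?case
      by (intro exI[of _ "a + a'"] exI[of _ "b + b'"]) (simp add: algebra_simps sum.distrib)
  next
    case (cong g h)
    then obtain a b where ab: "(g has_derivative (\<lambda>h. \<Sum>j\<in>UNIV. a $ j * h $ j + b $ j * cnj (h $ j))) (at z)"
      "\<forall>j. j \<notin> S \<longrightarrow> b $ j = 0" by blast
    have "(h has_derivative (\<lambda>h. \<Sum>j\<in>UNIV. a $ j * h $ j + b $ j * cnj (h $ j))) (at z)"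
      by (rule has_derivative_transform_within_open[OF ab(1) D z]) (use cong(2) in auto)
    with ab(2) show ?case by blast
  qed
  then obtain a b where ab: "(g has_derivative (\<lambda>h. \<Sum>j\<in>UNIV. a $ j * h $ j + b $ j * cnj (h $ j))) (at z)"
    "\<forall>j. j \<notin> S \<longrightarrow> b $ j = 0" by blast
  have "(\<chi> j. wirtinger_deriv j g z) = a"
    by (simp add: vec_eq_iff wirtinger_deriv_eq[OF ab(1)])
  with ab show ?thesis by blast
qed

lemma conj_holomorphic_continuous_on:
  fixes g :: "complex ^ 'n \<Rightarrow> complex"
  assumes "open D" "conj_holomorphic D S g"
  shows "continuous_on D g"
proof (rule continuous_at_imp_continuous_on, rule ballI)
  fix z assume z: "z \<in> D"
  obtain b where "(g has_derivative (\<lambda>h. \<Sum>j\<in>UNIV. (\<chi> j. wirtinger_deriv j g z) $ j * h $ j + b $ j * cnj (h $ j))) (at z)"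
    using conj_holomorphic_gradient[OF assms(1) z assms(2)] by blast
  from has_derivative_continuous[OF this(1)] show "isCont g z" .
qed

lemma wirtinger_deriv_add:
  fixes g h :: "complex ^ 'n \<Rightarrow> complex"
  assumes D: "open D" and z: "z \<in> D" and g: "conj_holomorphic D S g" and h: "conj_holomorphic D S h"
  shows "wirtinger_deriv j (\<lambda>z. g z + h z) z = wirtinger_deriv j g z + wirtinger_deriv j h z"
proof -
  obtain b where b: "(g has_derivative (\<lambda>h. \<Sum>j\<in>UNIV. (\<chi> j. wirtinger_deriv j g z) $ j * h $ j + b $ j * cnj (h $ j))) (at z)"
    using conj_holomorphic_gradient[OF D z g] by blast
  obtain b' where b': "(h has_derivative (\<lambda>x. \<Sum>j\<in>UNIV. (\<chi> j. wirtinger_deriv j h z) $ j * x $ j + b' $ j * cnj (x $ j))) (at z)"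
    using conj_holomorphic_gradient[OF D z h] by blast
  have "((\<lambda>z. g z + h z) has_derivative (\<lambda>x. \<Sum>j\<in>UNIV.
     ((\<chi> j. wirtinger_deriv j g z) + (\<chi> j. wirtinger_deriv j h z)) $ j * x $ j + (b + b') $ j * cnj (x $ j))) (at z)"
    using has_derivative_add[OF b b'] by (simp add: algebra_simps sum.distrib)
  from wirtinger_deriv_eq[OF this] show ?thesis by simp
qed

text \<open>
  The derivative of \<open>cnj(z\<^sub>k)\<close> is antilinear, so by the product rule such a factor behaves like a constant.
\<close>

lemma wirtinger_deriv_mult:
  fixes g :: "complex ^ 'n \<Rightarrow> complex"
  assumes D: "open D" and z: "z \<in> D" and g: "conj_holomorphic D S g"
  shows "wirtinger_deriv j (\<lambda>z. cnj (z $ k) * g z) z = cnj (z $ k) * wirtinger_deriv j g z"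
    and "wirtinger_deriv j (\<lambda>z. c * g z) z = c * wirtinger_deriv j g z"
proof -
  let ?a = "\<chi> j. wirtinger_deriv j g z"
  obtain b where b: "(g has_derivative (\<lambda>h. \<Sum>j\<in>UNIV. ?a $ j * h $ j + b $ j * cnj (h $ j))) (at z)"
    using conj_holomorphic_gradient[OF D z g] by blast
  have "((\<lambda>z. cnj (z $ k)) has_derivative (\<lambda>h. cnj (h $ k))) (at z)"
    by (intro bounded_linear_imp_has_derivative bounded_linear_compose[OF bounded_linear_cnj] bounded_linear_vec_nth)
  from has_derivative_mult[OF this b]
  have "((\<lambda>z. cnj (z $ k) * g z) has_derivative (\<lambda>h. cnj (z $ k) * (\<Sum>j\<in>UNIV. ?a $ j * h $ j + b $ j * cnj (h $ j)) + cnj (h $ k) * g z)) (at z)" .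
  also have "(\<lambda>h. cnj (z $ k) * (\<Sum>j\<in>UNIV. ?a $ j * h $ j + b $ j * cnj (h $ j)) + cnj (h $ k) * g z)
    = (\<lambda>h. \<Sum>j\<in>UNIV. (\<chi> j. cnj (z $ k) * ?a $ j) $ j * h $ j + (\<chi> j. cnj (z $ k) * b $ j + (if j = k then g z else 0)) $ j * cnj (h $ j))"
    by (rule ext) (simp add: sum_distrib_left sum.distrib algebra_simps if_distrib[of "\<lambda>x. _ * x"] cong: if_cong)
  finally show "wirtinger_deriv j (\<lambda>z. cnj (z $ k) * g z) z = cnj (z $ k) * wirtinger_deriv j g z"
    by (subst wirtinger_deriv_eq, assumption) simp
  have "((\<lambda>z. c * g z) has_derivative (\<lambda>h. \<Sum>j\<in>UNIV. (\<chi> j. c * ?a $ j) $ j * h $ j + (\<chi> j. c * b $ j) $ j * cnj (h $ j))) (at z)"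
    using has_derivative_mult_right[OF b, of c] by (simp add: sum_distrib_left algebra_simps)
  from wirtinger_deriv_eq[OF this, of j] show "wirtinger_deriv j (\<lambda>z. c * g z) z = c * wirtinger_deriv j g z"
    by simp
qed

lemma conj_holomorphic_wirtinger_deriv:
  fixes g :: "complex ^ 'n \<Rightarrow> complex"
  assumes D: "open D" and g: "conj_holomorphic D S g"
  shows "conj_holomorphic D S (wirtinger_deriv j g)"
  using g
proof (induction rule: conj_holomorphic.induct)
  case (holomorphic f)
  then show ?case by (intro conj_holomorphic.holomorphic holomorphic_several_wirtinger_deriv D)
next
  case (mult_cnj g k)
  show ?case
    by (rule conj_holomorphic.cong[OF conj_holomorphic.mult_cnj[OF mult_cnj(3,2)]])
      (simp add: wirtinger_deriv_mult(1)[OF D _ mult_cnj(1)])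
next
  case (add g h)
  show ?case
    by (rule conj_holomorphic.cong[OF conj_holomorphic.add[OF add(3,4)]])
      (simp add: wirtinger_deriv_add[OF D _ add(1,2)])
next
  case (cong g h)
  show ?case
    by (rule conj_holomorphic.cong[OF cong(3)]) (rule wirtinger_deriv_cong[OF D _ cong(2)])
qed

lemma wirtinger_deriv_commute:
  fixes g :: "complex ^ 'n \<Rightarrow> complex"
  assumes D: "open D" and g: "conj_holomorphic D S g" and z: "z \<in> D"
  shows "wirtinger_deriv k (wirtinger_deriv j g) z = wirtinger_deriv j (wirtinger_deriv k g) z"
  using g z
proof (induction arbitrary: z rule: conj_holomorphic.induct)
  case (holomorphic f)
  then show ?case by (rule wirtinger_deriv_commute_holomorphic[OF D])
next
  case (mult_cnj g l)
  have "wirtinger_deriv k (wirtinger_deriv j (\<lambda>z. cnj (z $ l) * g z)) z =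
      cnj (z $ l) * wirtinger_deriv k (wirtinger_deriv j g) z" for j k
    by (subst wirtinger_deriv_cong[OF D mult_cnj(4) wirtinger_deriv_mult(1)[OF D _ mult_cnj(1)]])
      (simp_all add: wirtinger_deriv_mult(1)[OF D mult_cnj(4) conj_holomorphic_wirtinger_deriv[OF D mult_cnj(1)]])
  then show ?case using mult_cnj by simp
next
  case (add g h)
  have "wirtinger_deriv k (wirtinger_deriv j (\<lambda>z. g z + h z)) z =
      wirtinger_deriv k (wirtinger_deriv j g) z + wirtinger_deriv k (wirtinger_deriv j h) z" for j k
    by (subst wirtinger_deriv_cong[OF D add(5) wirtinger_deriv_add[OF D _ add(1,2)]])
      (simp_all add: wirtinger_deriv_add[OF D add(5)
        conj_holomorphic_wirtinger_deriv[OF D add(1)] conj_holomorphic_wirtinger_deriv[OF D add(2)]])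
  then show ?case using add by simp
next
  case (cong g h)
  have "wirtinger_deriv k (wirtinger_deriv j h) z = wirtinger_deriv k (wirtinger_deriv j g) z" for j k
    by (rule wirtinger_deriv_cong[OF D cong(4) wirtinger_deriv_cong[OF D _ cong(2)]])
  then show ?case using cong by simp
qed

section \<open>The operators as derivatives of slices\<close>

text \<open>
  With \<open>b = cnj(w\<^sub>j)\<close>, \<open>tangent_vec\<close> is the direction \<open>v\<^sub>j(w)\<close> and \<open>tangent_deriv\<close> is the operator \<open>\<L>\<^sub>j\<close> with
  its variable coefficient frozen at the point \<open>w\<close>. The coefficient 0 for the last index lets \<open>\<L>\<^sub>n\<close> be
  treated together with the other operators.
\<close>

definition tangent_coeff :: "'n::{finite,linorder} \<Rightarrow> complex \<Rightarrow> complex" where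
  "tangent_coeff j b = (if j = last_index then 0 else 2 * \<i> * b)"

definition tangent_vec :: "'n::{finite,linorder} \<Rightarrow> complex \<Rightarrow> complex ^ 'n::{finite,linorder}" where
  "tangent_vec j b = axis j 1 + axis last_index (tangent_coeff j b)"

definition tangent_deriv ::
  "'n::{finite,linorder} \<Rightarrow> complex \<Rightarrow> (complex ^ 'n::{finite,linorder} \<Rightarrow> complex) \<Rightarrow> complex ^ 'n::{finite,linorder} \<Rightarrow> complex" where
  "tangent_deriv j b g z = wirtinger_deriv j g z + tangent_coeff j b * wirtinger_deriv last_index g z"

lemma siegel_L_eq_tangent_deriv: "siegel_L j g z = tangent_deriv j (cnj (z $ j)) g z"
  by (simp add: siegel_L_def tangent_deriv_def tangent_coeff_def)

lemma conj_holomorphic_tangent_deriv: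
  assumes "open D" "conj_holomorphic D S g"
  shows "conj_holomorphic D S (tangent_deriv j b g)"
  unfolding tangent_deriv_def[abs_def]
  by (intro conj_holomorphic.add conj_holomorphic_const_mult conj_holomorphic_wirtinger_deriv assms)

lemma conj_holomorphic_siegel_L:
  assumes D: "open D" and g: "conj_holomorphic D S g" and j: "j \<in> S \<or> j = last_index"
  shows "conj_holomorphic D S (siegel_L j g)"
proof (cases "j = last_index")
  case True
  then show ?thesis
    using conj_holomorphic_wirtinger_deriv[OF D g] by (simp add: siegel_L_def[abs_def])
next
  case False
  have "conj_holomorphic D S (\<lambda>z. wirtinger_deriv j g z + (2 * \<i>) * (cnj (z $ j) * wirtinger_deriv last_index g z))"
    using False j
    by (intro conj_holomorphic.add conj_holomorphic_const_mult conj_holomorphic.mult_cnj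
        conj_holomorphic_wirtinger_deriv D g) auto
  then show ?thesis using False by (simp add: siegel_L_def[abs_def] mult.assoc)
qed

lemma conj_holomorphic_siegel_L_power:
  assumes D: "open D" and g: "conj_holomorphic D S g" and j: "j \<in> S \<or> j = last_index"
  shows "conj_holomorphic D S ((siegel_L j ^^ a) g)"
  by (induction a) (simp_all add: g conj_holomorphic_siegel_L[OF D _ j])

lemma siegel_L_cong:
  assumes "open D" "z \<in> D" "\<And>x. x \<in> D \<Longrightarrow> g x = h x"
  shows "siegel_L j g z = siegel_L j h z"
  unfolding siegel_L_def using wirtinger_deriv_cong[of D z g h, OF assms] by simp

lemma tangent_deriv_siegel_L_commute:
  assumes D: "open D" and g: "conj_holomorphic D S g" and z: "z \<in> D"
  shows "tangent_deriv j b (siegel_L j g) z = siegel_L j (tangent_deriv j b g) z"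
proof (cases "j = last_index")
  case True
  then show ?thesis
    by (simp add: siegel_L_eq_tangent_deriv[abs_def] tangent_deriv_def[abs_def] tangent_coeff_def)
next
  case False
  let ?W = wirtinger_deriv
  let ?n = "last_index :: 'a"
  have W: "conj_holomorphic D (insert j S) (?W k g)" "conj_holomorphic D (insert j S) (?W k (?W l g))" for k l
    by (intro conj_holomorphic_wirtinger_deriv D conj_holomorphic_mono[OF g]; blast)+
  have cm: "conj_holomorphic D (insert j S) (\<lambda>z. c * ?W l g z)" for c l
    by (intro conj_holomorphic_const_mult W)
  have cnj: "conj_holomorphic D (insert j S) (\<lambda>z. cnj (z $ j) * ?W l g z)" for l
    by (intro conj_holomorphic.mult_cnj W) simp
  have L: "siegel_L j g = (\<lambda>z. ?W j g z + (2 * \<i>) * (cnj (z $ j) * ?W ?n g z))"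
    using False by (simp add: siegel_L_def[abs_def] mult.assoc)
  have WL: "?W k (siegel_L j g) z = ?W k (?W j g) z + (2 * \<i>) * (cnj (z $ j) * ?W k (?W ?n g) z)" for k
    unfolding L
    by (simp add: wirtinger_deriv_add[OF D z W(1) conj_holomorphic_const_mult[OF cnj]]
        wirtinger_deriv_mult(2)[OF D z cnj] wirtinger_deriv_mult(1)[OF D z W(1)])
  have WT: "?W k (tangent_deriv j b g) z = ?W k (?W j g) z + tangent_coeff j b * ?W k (?W ?n g) z" for k
    unfolding tangent_deriv_def[abs_def]
    by (simp add: wirtinger_deriv_add[OF D z W(1) cm] wirtinger_deriv_mult(2)[OF D z W(1)])
  have c: "?W j (?W ?n g) z = ?W ?n (?W j g) z"
    by (rule wirtinger_deriv_commute[OF D g z])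
  have "tangent_deriv j b (siegel_L j g) z
    = ?W j (siegel_L j g) z + tangent_coeff j b * ?W ?n (siegel_L j g) z"
    by (simp add: tangent_deriv_def)
  also have "\<dots> = ?W j (tangent_deriv j b g) z + 2 * \<i> * cnj (z $ j) * ?W ?n (tangent_deriv j b g) z"
    unfolding WL WT by (simp add: c algebra_simps)
  also have "\<dots> = siegel_L j (tangent_deriv j b g) z"
    using False by (simp add: siegel_L_def)
  finally show ?thesis .
qed

text \<open>
  At the point where the coefficient is frozen, \<open>\<L>\<^sub>j\<close> and the frozen operator agree. Since they commute,
  the outermost factor of a power of \<open>\<L>\<^sub>j\<close> can be replaced by the frozen operator and moved to the inside,
  and induction replaces all of them.
\<close>

lemma siegel_L_power_eq_tangent_deriv_power:
  assumes D: "open D" and g: "conj_holomorphic D S g" and z: "z \<in> D"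
  shows "(siegel_L j ^^ a) g z = (tangent_deriv j (cnj (z $ j)) ^^ a) g z"
proof -
  let ?b = "cnj (z $ j)"
  have comm: "tangent_deriv j ?b ((siegel_L j ^^ a) g) x = (siegel_L j ^^ a) (tangent_deriv j ?b g) x"
    if "x \<in> D" "conj_holomorphic D (insert j S) g" for a g x
    using that(1)
  proof (induction a arbitrary: x)
    case (Suc a)
    have "tangent_deriv j ?b ((siegel_L j ^^ Suc a) g) x = siegel_L j (tangent_deriv j ?b ((siegel_L j ^^ a) g)) x"
      using tangent_deriv_siegel_L_commute[OF D conj_holomorphic_siegel_L_power[OF D that(2), of j] Suc.prems]
      by simp
    also have "\<dots> = siegel_L j ((siegel_L j ^^ a) (tangent_deriv j ?b g)) x"
      by (rule siegel_L_cong[OF D Suc.prems Suc.IH])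
    finally show ?case by simp
  qed simp
  have g': "conj_holomorphic D (insert j S) g" by (rule conj_holomorphic_mono[OF g]) blast
  then show ?thesis
  proof (induction a arbitrary: g)
    case (Suc a)
    have "(siegel_L j ^^ Suc a) g z = tangent_deriv j ?b ((siegel_L j ^^ a) g) z"
      by (simp add: siegel_L_eq_tangent_deriv)
    also have "\<dots> = (siegel_L j ^^ a) (tangent_deriv j ?b g) z"
      by (rule comm[OF z Suc.prems])
    also have "\<dots> = (tangent_deriv j ?b ^^ a) (tangent_deriv j ?b g) z"
      by (rule Suc.IH[OF conj_holomorphic_tangent_deriv[OF D Suc.prems]])
    finally show ?case by (simp add: funpow_swap1)
  qed simp
qed

lemma axis_nth_mult: "axis j c $ k * x = (if k = j then c * x else (0::complex))"
  by (simp add: axis_def)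

lemma tangent_slice_has_derivative:
  assumes D: "open D" and g: "conj_holomorphic D S g" and j: "j \<notin> S" "last_index \<notin> S"
    and w: "w + \<zeta> *s tangent_vec j b \<in> D"
  shows "((\<lambda>\<zeta>. g (w + \<zeta> *s tangent_vec j b)) has_field_derivative
           tangent_deriv j b g (w + \<zeta> *s tangent_vec j b)) (at \<zeta>)"
proof -
  let ?z = "w + \<zeta> *s tangent_vec j b"
  obtain B where B: "(g has_derivative (\<lambda>h. \<Sum>j\<in>UNIV. (\<chi> j. wirtinger_deriv j g ?z) $ j * h $ j + B $ j * cnj (h $ j))) (at ?z)"
    "\<forall>j. j \<notin> S \<longrightarrow> B $ j = 0" using conj_holomorphic_gradient[OF D w g] by blast
  have "B $ k = 0 \<or> tangent_vec j b $ k = 0" for k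
    using B(2) j by (auto simp: tangent_vec_def axis_def)
  from has_derivative_slice[OF B(1) this]
  have "((\<lambda>\<zeta>. g (w + \<zeta> *s tangent_vec j b)) has_field_derivative
     (\<Sum>k\<in>UNIV. tangent_vec j b $ k * wirtinger_deriv k g ?z)) (at \<zeta>)" by simp
  also have "(\<Sum>k\<in>UNIV. tangent_vec j b $ k * wirtinger_deriv k g ?z) = tangent_deriv j b g ?z"
    by (simp add: tangent_vec_def tangent_deriv_def axis_nth_mult distrib_right sum.distrib)
  finally show ?thesis .
qed

lemma deriv_power_tangent_slice:
  assumes D: "open D" and g: "conj_holomorphic D S g" and j: "j \<notin> S" "last_index \<notin> S"
    and w: "\<And>\<zeta>. \<zeta> \<in> ball 0 R \<Longrightarrow> w + \<zeta> *s tangent_vec j b \<in> D" and \<zeta>: "\<zeta> \<in> ball 0 R"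
  shows "(deriv ^^ a) (\<lambda>\<zeta>. g (w + \<zeta> *s tangent_vec j b)) \<zeta> = (tangent_deriv j b ^^ a) g (w + \<zeta> *s tangent_vec j b)"
  using \<zeta>
proof (induction a arbitrary: \<zeta>)
  case (Suc a)
  have h: "conj_holomorphic D S ((tangent_deriv j b ^^ a) g)"
    by (induction a) (auto intro: g conj_holomorphic_tangent_deriv D)
  have "(deriv ^^ Suc a) (\<lambda>\<zeta>. g (w + \<zeta> *s tangent_vec j b)) \<zeta>
      = deriv (\<lambda>\<zeta>. (tangent_deriv j b ^^ a) g (w + \<zeta> *s tangent_vec j b)) \<zeta>"
  proof (simp, rule deriv_cong_ev)
    show "\<forall>\<^sub>F x in nhds \<zeta>. (deriv ^^ a) (\<lambda>\<zeta>. g (w + \<zeta> *s tangent_vec j b)) x =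
       (tangent_deriv j b ^^ a) g (w + x *s tangent_vec j b)"
      using eventually_nhds_in_open[OF open_ball Suc.prems]
      by eventually_elim (rule Suc.IH)
  qed simp
  also have "\<dots> = tangent_deriv j b ((tangent_deriv j b ^^ a) g) (w + \<zeta> *s tangent_vec j b)"
    by (intro DERIV_imp_deriv tangent_slice_has_derivative[OF D h j] w Suc.prems)
  finally show ?case by simp
qed simp

text \<open>
  The Cauchy estimate for \<open>\<L>\<^sub>j\<^sup>a g\<close>, with the mean over the circle in place of the maximum. The index
  \<open>j\<close> has to lie outside \<open>S\<close> because the slice moves in the coordinates \<open>j\<close> and \<open>n\<close>.
\<close>

lemma siegel_L_power_circle_bound:
  fixes r R :: real
  assumes D: "open D" and g: "conj_holomorphic D S g" and j: "j \<notin> S" "last_index \<notin> S"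
    and w: "\<And>\<zeta>. \<zeta> \<in> ball 0 R \<Longrightarrow> w + \<zeta> *s tangent_vec j (cnj (w $ j)) \<in> D"
    and r: "0 < r" "r < R"
  shows "continuous_on {0..1} (\<lambda>t. cmod (g (w + (r * cis (2 * pi * t)) *s tangent_vec j (cnj (w $ j)))))"
    and "cmod ((siegel_L j ^^ a) g w) * r ^ a \<le>
      fact a * integral {0..1} (\<lambda>t. cmod (g (w + (r * cis (2 * pi * t)) *s tangent_vec j (cnj (w $ j)))))"
proof -
  define v where "v = tangent_vec j (cnj (w $ j))"
  define h where "h = (\<lambda>\<zeta>. g (w + \<zeta> *s v))"
  have w': "w + \<zeta> *s v \<in> D" if "\<zeta> \<in> ball 0 R" for \<zeta>
    using w[OF that] by (simp add: v_def)
  have hol: "h holomorphic_on ball 0 R"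
    unfolding h_def v_def
    by (rule holomorphic_onI)
      (use tangent_slice_has_derivative[OF D g j w] in
        \<open>auto simp: field_differentiable_def intro: has_field_derivative_at_within\<close>)
  have cont: "continuous_on {0..1} (\<lambda>t. h (r * cis (2 * pi * t)))"
    by (rule continuous_on_compose2[OF holomorphic_on_imp_continuous_on[OF hol]])
      (use r in \<open>auto simp: norm_mult intro!: continuous_intros\<close>)
  show c: "continuous_on {0..1} (\<lambda>t. cmod (g (w + (r * cis (2 * pi * t)) *s tangent_vec j (cnj (w $ j)))))"
    using continuous_on_norm[OF cont] by (simp add: h_def v_def)
  have "w \<in> D" using w[of 0] r by simp
  have "(deriv ^^ a) h 0 = (tangent_deriv j (cnj (w $ j)) ^^ a) g (w + 0 *s v)"
    unfolding h_def v_def by (rule deriv_power_tangent_slice[OF D g j w]) (use r in auto)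
  also have "\<dots> = (siegel_L j ^^ a) g w"
    using siegel_L_power_eq_tangent_deriv_power[OF D g \<open>w \<in> D\<close>] by simp
  finally have "cmod ((siegel_L j ^^ a) g w) * r ^ a = cmod ((deriv ^^ a) h 0 * r ^ a)"
    using r by (simp add: norm_mult norm_power)
  also have "\<dots> = fact a * cmod (integral {0..1} (\<lambda>t. h (r * cis (2 * pi * t)) * cis (- (2 * pi * t)) ^ a))"
    unfolding deriv_circle_average[OF hol r] by (simp add: norm_mult)
  also have "cmod (integral {0..1} (\<lambda>t. h (r * cis (2 * pi * t)) * cis (- (2 * pi * t)) ^ a))
      \<le> integral {0..1} (\<lambda>t. cmod (h (r * cis (2 * pi * t))))"
    by (intro integral_norm_bound_integral integrable_continuous_interval continuous_intros cont)
      (auto simp: norm_mult norm_power)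
  finally show "cmod ((siegel_L j ^^ a) g w) * r ^ a \<le>
      fact a * integral {0..1} (\<lambda>t. cmod (g (w + (r * cis (2 * pi * t)) *s tangent_vec j (cnj (w $ j)))))"
    by (simp add: h_def v_def)
qed

lemma siegel_domain_eq: "siegel_domain = {z. 0 < siegel_rho z}"
  by (auto simp: siegel_domain_def siegel_rho_def)

lemma continuous_siegel_rho: "continuous_on UNIV siegel_rho"
  unfolding siegel_rho_def[abs_def] by (intro continuous_intros)

lemma open_siegel_domain: "open (siegel_domain :: (complex ^ 'n::{finite,linorder}) set)"
  unfolding siegel_domain_eq using open_Collect_less[OF continuous_on_const continuous_siegel_rho] .

text \<open>
  The term \<open>2 Re(cnj(w\<^sub>j) \<zeta>)\<close> in \<open>|w\<^sub>j + \<zeta>|\<^sup>2\<close> cancels against the imaginary part of \<open>2 \<i> cnj(w\<^sub>j) \<zeta>\<close>: the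
  directions \<open>v\<^sub>j(w)\<close> with \<open>j < n\<close> are tangent to the level sets of \<open>\<rho>\<close>.
\<close>

lemma siegel_rho_add_tangent:
  "siegel_rho (w + \<zeta> *s tangent_vec j (cnj (w $ j))) =
     (if j = last_index then siegel_rho w + Im \<zeta> else siegel_rho w - (cmod \<zeta>)\<^sup>2)"
proof (cases "j = last_index")
  case True
  have "(\<Sum>k\<in>UNIV - {last_index}. (cmod ((w + \<zeta> *s tangent_vec j (cnj (w $ j))) $ k))\<^sup>2) =
     (\<Sum>k\<in>UNIV - {last_index}. (cmod (w $ k))\<^sup>2)"
    using True by (intro sum.cong) (auto simp: tangent_vec_def tangent_coeff_def axis_def)
  then show ?thesis using True
    by (simp add: siegel_rho_def tangent_vec_def tangent_coeff_def axis_def)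
next
  case False
  have "(\<Sum>k\<in>UNIV - {last_index}. (cmod ((w + \<zeta> *s tangent_vec j (cnj (w $ j))) $ k))\<^sup>2) =
     (\<Sum>k\<in>UNIV - {last_index}. (cmod (w $ k))\<^sup>2 + (if k = j then (cmod (w $ j + \<zeta>))\<^sup>2 - (cmod (w $ j))\<^sup>2 else 0))"
    using False by (intro sum.cong) (auto simp: tangent_vec_def tangent_coeff_def axis_def)
  also have "\<dots> = (\<Sum>k\<in>UNIV - {last_index}. (cmod (w $ k))\<^sup>2) + ((cmod (w $ j + \<zeta>))\<^sup>2 - (cmod (w $ j))\<^sup>2)"
    using False by (simp add: sum.distrib)
  also have "(cmod (w $ j + \<zeta>))\<^sup>2 = (cmod (w $ j))\<^sup>2 + (cmod \<zeta>)\<^sup>2 + 2 * (Re (w $ j) * Re \<zeta> + Im (w $ j) * Im \<zeta>)"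
    by (simp only: cmod_power2) (simp add: power2_eq_square algebra_simps)
  finally show ?thesis using False
    by (simp add: siegel_rho_def tangent_vec_def tangent_coeff_def axis_def algebra_simps)
qed

section \<open>Shears, means and Tonelli\<close>

lemma nn_integral_lborel_coordinate:
  fixes G :: "'a::euclidean_space \<Rightarrow> ennreal"
  assumes G[measurable]: "G \<in> borel_measurable borel" and b: "b \<in> Basis"
  shows "(\<integral>\<^sup>+ x. G x \<partial>lborel) =
    (\<integral>\<^sup>+ x. (\<integral>\<^sup>+ y. G ((\<Sum>i\<in>Basis - {b}. x i *\<^sub>R i) + y *\<^sub>R b) \<partial>lborel) \<partial>(\<Pi>\<^sub>M i\<in>Basis - {b}. lborel))"
proof -
  interpret product_sigma_finite "\<lambda>_::'a. lborel :: real measure" by standard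
  have m: "(\<lambda>f. \<Sum>i\<in>Basis. f i *\<^sub>R i) \<in> (\<Pi>\<^sub>M b\<in>Basis. lborel) \<rightarrow>\<^sub>M (borel :: 'a measure)"
    by measurable
  have ins: "insert b (Basis - {b}) = (Basis :: 'a set)" using b by auto
  have m2: "(\<lambda>f. G (\<Sum>i\<in>Basis. f i *\<^sub>R i)) \<in> borel_measurable (\<Pi>\<^sub>M b\<in>Basis. lborel)"
    using m by measurable
  have e: "(\<Sum>i\<in>Basis. (x(b := y)) i *\<^sub>R i) = (\<Sum>i\<in>Basis - {b}. x i *\<^sub>R i) + y *\<^sub>R b" for x :: "'a \<Rightarrow> real" and y
    by (subst sum.remove[OF finite_Basis b]) (simp add: add.commute)
  have "(\<integral>\<^sup>+ x. G x \<partial>lborel) = (\<integral>\<^sup>+ f. G (\<Sum>i\<in>Basis. f i *\<^sub>R i) \<partial>(\<Pi>\<^sub>M b\<in>Basis. lborel))"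
    by (subst lborel_eq) (rule nn_integral_distr, use m G in auto)
  also have "\<dots> = (\<integral>\<^sup>+ f. G (\<Sum>i\<in>Basis. f i *\<^sub>R i) \<partial>(\<Pi>\<^sub>M b\<in>insert b (Basis - {b}). lborel))"
    by (simp only: ins)
  also have "\<dots> = (\<integral>\<^sup>+ x. (\<integral>\<^sup>+ y. G (\<Sum>i\<in>Basis. (x(b := y)) i *\<^sub>R i) \<partial>lborel) \<partial>(\<Pi>\<^sub>M i\<in>Basis - {b}. lborel))"
    by (rule product_nn_integral_insert) (use m2 in \<open>simp_all only: ins, auto\<close>)
  finally show ?thesis by (simp only: e)
qed

text \<open>
  A map that changes only the coordinate \<open>b\<close>, by an affine function with slope \<open>c\<close> on each line parallel to
  \<open>b\<close>, scales volume by \<open>c\<close>. The shears (\<open>c = 1\<close>) and the dilations below are of this kind.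
\<close>

lemma nn_integral_lborel_coordinate_affine:
  fixes F :: "'a::euclidean_space \<Rightarrow> ennreal"
  assumes F[measurable]: "F \<in> borel_measurable borel" and b: "b \<in> Basis"
    and k[measurable]: "k \<in> borel_measurable borel" and kb: "\<And>x s. k (x + s *\<^sub>R b) = k x" and c: "0 < c"
  shows "(\<integral>\<^sup>+ x. F x \<partial>lborel) = ennreal c * (\<integral>\<^sup>+ x. F (x + (k x + (c - 1) * (x \<bullet> b)) *\<^sub>R b) \<partial>lborel)"
proof -
  let ?s = "\<lambda>x :: 'a \<Rightarrow> real. \<Sum>i\<in>Basis - {b}. x i *\<^sub>R i"
  have ms[measurable]: "?s \<in> (\<Pi>\<^sub>M i\<in>Basis - {b}. lborel) \<rightarrow>\<^sub>M borel" by measurable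
  have sb: "?s x \<bullet> b = 0" for x
    using b by (auto simp: inner_sum_left inner_Basis intro!: sum.neutral)
  have bb: "b \<bullet> b = 1" using b by simp
  have "(\<integral>\<^sup>+ x. F x \<partial>lborel) =
     (\<integral>\<^sup>+ x. (\<integral>\<^sup>+ y. F (?s x + y *\<^sub>R b) \<partial>lborel) \<partial>(\<Pi>\<^sub>M i\<in>Basis - {b}. lborel))"
    by (rule nn_integral_lborel_coordinate[OF F b])
  also have "\<dots> = (\<integral>\<^sup>+ x. ennreal c * (\<integral>\<^sup>+ y. F (?s x + (k (?s x) + c * y) *\<^sub>R b) \<partial>lborel) \<partial>(\<Pi>\<^sub>M i\<in>Basis - {b}. lborel))"
  proof (rule nn_integral_cong)
    fix x
    show "(\<integral>\<^sup>+ y. F (?s x + y *\<^sub>R b) \<partial>lborel) = ennreal c * (\<integral>\<^sup>+ y. F (?s x + (k (?s x) + c * y) *\<^sub>R b) \<partial>lborel)"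
      using nn_integral_real_affine[of "\<lambda>y. F (?s x + y *\<^sub>R b)" c "k (?s x)"] c by simp
  qed
  also have "\<dots> = ennreal c * (\<integral>\<^sup>+ x. (\<integral>\<^sup>+ y. F (?s x + (k (?s x) + c * y) *\<^sub>R b) \<partial>lborel) \<partial>(\<Pi>\<^sub>M i\<in>Basis - {b}. lborel))"
    by (rule nn_integral_cmult) measurable
  also have "(\<integral>\<^sup>+ x. (\<integral>\<^sup>+ y. F (?s x + (k (?s x) + c * y) *\<^sub>R b) \<partial>lborel) \<partial>(\<Pi>\<^sub>M i\<in>Basis - {b}. lborel)) =
     (\<integral>\<^sup>+ x. F (x + (k x + (c - 1) * (x \<bullet> b)) *\<^sub>R b) \<partial>lborel)"
  proof -
    have e: "?s x + y *\<^sub>R b + (k (?s x + y *\<^sub>R b) + (c - 1) * ((?s x + y *\<^sub>R b) \<bullet> b)) *\<^sub>R b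
        = ?s x + (k (?s x) + c * y) *\<^sub>R b" for x y
      using kb[of "?s x" y] by (simp add: inner_add_left sb bb algebra_simps)
    have "(\<integral>\<^sup>+ x. F (x + (k x + (c - 1) * (x \<bullet> b)) *\<^sub>R b) \<partial>lborel) =
       (\<integral>\<^sup>+ x. (\<integral>\<^sup>+ y. F (?s x + y *\<^sub>R b + (k (?s x + y *\<^sub>R b) + (c - 1) * ((?s x + y *\<^sub>R b) \<bullet> b)) *\<^sub>R b) \<partial>lborel) \<partial>(\<Pi>\<^sub>M i\<in>Basis - {b}. lborel))"
      by (rule nn_integral_lborel_coordinate[OF _ b]) measurable
    then show ?thesis by (simp only: e)
  qed
  finally show ?thesis .
qed

lemma nn_integral_lborel_translation:
  fixes F :: "'a::euclidean_space \<Rightarrow> ennreal"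
  assumes F: "F \<in> borel_measurable borel"
  shows "(\<integral>\<^sup>+ x. F (x + a) \<partial>lborel) = (\<integral>\<^sup>+ x. F x \<partial>lborel)"
  by (subst (2) lborel_distr_plus[symmetric, of a], subst nn_integral_distr)
    (use F in \<open>auto simp: add.commute\<close>)

text \<open>
  The map consists of two shears, in the real and in the imaginary part of the last coordinate, and a
  translation in the coordinate \<open>j\<close>.
\<close>

lemma nn_integral_tangent_shift:
  fixes F :: "complex ^ 'n::{finite,linorder} \<Rightarrow> ennreal"
  assumes F[measurable]: "F \<in> borel_measurable borel"
  shows "(\<integral>\<^sup>+ w. F (w + \<zeta> *s tangent_vec j (cnj (w $ j))) \<partial>lborel) = (\<integral>\<^sup>+ w. F w \<partial>lborel)"
proof -
  define \<tau> where "\<tau> = (\<lambda>w :: (complex, 'n) vec. \<zeta> * tangent_coeff j (cnj (w $ j)))"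
  have \<tau>[measurable]: "\<tau> \<in> borel_measurable borel"
    unfolding \<tau>_def
    by (cases "j = last_index")
      (auto simp: tangent_coeff_def intro!: borel_measurable_continuous_onI continuous_intros)
  let ?e = "\<lambda>c. axis (last_index :: 'n) c :: (complex, 'n) vec"
  have B: "?e 1 \<in> Basis" "?e \<i> \<in> Basis" by (simp_all add: Basis_complex_def)
  have \<tau>_e: "\<tau> (w + s *\<^sub>R ?e c) = \<tau> w" for w s c
    by (auto simp: \<tau>_def tangent_coeff_def axis_def)
  define F1 where "F1 = (\<lambda>w. F (w + axis j \<zeta>))"
  define F2 where "F2 = (\<lambda>w. F1 (w + Im (\<tau> w) *\<^sub>R ?e \<i>))"
  have F1[measurable]: "F1 \<in> borel_measurable borel" unfolding F1_def by measurable
  have F2[measurable]: "F2 \<in> borel_measurable borel" unfolding F2_def by measurable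
  have "(\<integral>\<^sup>+ w. F w \<partial>lborel) = (\<integral>\<^sup>+ w. F1 w \<partial>lborel)"
    unfolding F1_def by (rule nn_integral_lborel_translation[symmetric, OF F])
  also have "\<dots> = (\<integral>\<^sup>+ w. F2 w \<partial>lborel)"
    unfolding F2_def
    using nn_integral_lborel_coordinate_affine[OF F1 B(2), of "\<lambda>w. Im (\<tau> w)" 1] by (simp add: \<tau>_e)
  also have "\<dots> = (\<integral>\<^sup>+ w. F2 (w + Re (\<tau> w) *\<^sub>R ?e 1) \<partial>lborel)"
    using nn_integral_lborel_coordinate_affine[OF F2 B(1), of "\<lambda>w. Re (\<tau> w)" 1] by (simp add: \<tau>_e)
  also have "(\<lambda>w. F2 (w + Re (\<tau> w) *\<^sub>R ?e 1)) = (\<lambda>w. F (w + \<zeta> *s tangent_vec j (cnj (w $ j))))"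
  proof
    fix w :: "(complex, 'n) vec"
    have "Re (\<tau> w) *\<^sub>R ?e 1 + Im (\<tau> w) *\<^sub>R ?e \<i> = ?e (\<tau> w)"
      by (simp add: vec_eq_iff axis_def complex_eq_iff)
    moreover have "\<zeta> *s tangent_vec j (cnj (w $ j)) = axis j \<zeta> + ?e (\<tau> w)"
      by (simp add: vec_eq_iff axis_def tangent_vec_def \<tau>_def algebra_simps)
    ultimately show "F2 (w + Re (\<tau> w) *\<^sub>R ?e 1) = F (w + \<zeta> *s tangent_vec j (cnj (w $ j)))"
      by (simp add: F2_def F1_def \<tau>_e add_ac)
  qed
  finally show ?thesis by simp
qed

lemma powr_above_tangent:
  fixes x m p :: real
  assumes "1 \<le> p" "0 < m" "0 \<le> x"
  shows "m powr p + p * m powr (p - 1) * (x - m) \<le> x powr p"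
proof (cases "x = 0")
  case True
  have "m powr (p - 1) * m = m powr p" using assms by (simp add: powr_mult_base mult.commute)
  then have "m powr p + p * m powr (p - 1) * (x - m) = (1 - p) * m powr p"
    using True by (simp add: algebra_simps)
  also have "\<dots> \<le> 0" using assms by (simp add: mult_nonpos_nonneg)
  finally show ?thesis using True by simp
next
  case False
  have "(p * m powr (p - 1)) * (x - m) \<le> x powr p - m powr p"
  proof (rule convex_on_imp_above_tangent[OF powr_convex[OF assms(1)]])
    show "((\<lambda>x. x powr p) has_real_derivative p * m powr (p - 1)) (at m within {0<..})"
      using assms by (auto intro!: derivative_eq_intros)
  qed (use assms False in \<open>auto simp: interior_open\<close>)
  then show ?thesis by simp
qed

text \<open>
  Jensen's inequality follows by integrating the tangent of \<open>x powr p\<close> at the mean of \<open>h\<close>,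
  which lies below the convex function \<open>x powr p\<close>.
\<close>

lemma integral_powr_Jensen:
  fixes h :: "real \<Rightarrow> real"
  assumes p: "1 \<le> p" and h: "continuous_on {0..1} h" "\<And>t. t \<in> {0..1} \<Longrightarrow> 0 \<le> h t"
  shows "(integral {0..1} h) powr p \<le> integral {0..1} (\<lambda>t. h t powr p)"
proof -
  define m where "m = integral {0..1} h"
  have hi: "h integrable_on {0..1}" by (rule integrable_continuous_interval[OF h(1)])
  have cp: "continuous_on {0..1} (\<lambda>t. h t powr p)"
    using p h by (intro continuous_on_powr' h(1) continuous_on_const) auto
  have m0: "0 \<le> m" unfolding m_def by (rule integral_nonneg[OF hi]) (use h in auto)
  show ?thesis
  proof (cases "m = 0")
    case True
    then show ?thesis using integral_nonneg[OF integrable_continuous_interval[OF cp]]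
      by (simp add: m_def[symmetric])
  next
    case False
    then have m: "0 < m" using m0 by simp
    have "m powr p = integral {0..1} (\<lambda>t. m powr p + p * m powr (p - 1) * (h t - m))"
    proof -
      have "((\<lambda>t. m powr p + p * m powr (p - 1) * (h t - m)) has_integral
         (m powr p + p * m powr (p - 1) * (m - m))) {0..1}"
        using has_integral_add[OF has_integral_const_real[of "m powr p" 0 1]
            has_integral_mult_right[OF has_integral_diff[OF integrable_integral[OF hi] has_integral_const_real[of m 0 1]], of "p * m powr (p - 1)"]]
        by (simp add: m_def)
      then show ?thesis by (simp add: integral_unique)
    qed
    also have "\<dots> \<le> integral {0..1} (\<lambda>t. h t powr p)"
      by (intro integral_le integrable_continuous_interval cp continuous_intros h(1) powr_above_tangent p m)
        (use h in auto)
    finally show ?thesis by (simp add: m_def)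
  qed
qed

lemma nn_integral_powr_Jensen:
  fixes h :: "real \<Rightarrow> real"
  assumes p: "1 \<le> p" and h: "continuous_on {0..1} h" "\<And>t. t \<in> {0..1} \<Longrightarrow> 0 \<le> h t"
  shows "ennreal ((integral {0..1} h) powr p) \<le> (\<integral>\<^sup>+ t. indicator {0..1} t * ennreal (h t powr p) \<partial>lborel)"
proof -
  have cp: "continuous_on {0..1} (\<lambda>t. h t powr p)"
    using p h by (intro continuous_on_powr' h(1) continuous_on_const) auto
  let ?g = "\<lambda>t. indicator {0..1} t *\<^sub>R (h t powr p)"
  have "(\<integral>\<^sup>+ t. ennreal (?g t) \<partial>lborel) = ennreal (integral {0..1} (\<lambda>t. h t powr p))"
  proof (rule nn_integral_has_integral_lborel)
    show "?g \<in> borel_measurable borel" by (rule borel_measurable_continuous_on_indicator[OF _ cp]) simp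
    have "?g = (\<lambda>t. if t \<in> {0..1} then h t powr p else 0)" by (auto simp: indicator_def)
    then show "(?g has_integral integral {0..1} (\<lambda>t. h t powr p)) UNIV"
      using integrable_integral[OF integrable_continuous_interval[OF cp]]
      by (simp only: has_integral_restrict_UNIV)
  qed simp
  moreover have "ennreal (?g t) = indicator {0..1} t * ennreal (h t powr p)" for t
    by (simp add: indicator_def)
  ultimately show ?thesis using integral_powr_Jensen[OF assms] by (simp add: ennreal_leI)
qed

text \<open>
  Averaging over a family of measure preserving maps does not change the integral, even if the averaged
  function depends on the parameter of the family.
\<close>

lemma nn_integral_average_shift:
  fixes \<Phi> :: "'q::euclidean_space \<Rightarrow> 'a::euclidean_space \<Rightarrow> ennreal"
  assumes m1: "(\<lambda>(w, q). \<Phi> q (S q w)) \<in> borel_measurable borel"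
    and m2: "(\<lambda>(w, q). \<Phi> q w) \<in> borel_measurable borel"
    and S: "\<And>q. (\<integral>\<^sup>+ w. \<Phi> q (S q w) \<partial>lborel) = (\<integral>\<^sup>+ w. \<Phi> q w \<partial>lborel)"
  shows "(\<integral>\<^sup>+ w. (\<integral>\<^sup>+ q. \<Phi> q (S q w) \<partial>lborel) \<partial>lborel) = (\<integral>\<^sup>+ w. (\<integral>\<^sup>+ q. \<Phi> q w \<partial>lborel) \<partial>lborel)"
proof -
  have "(\<integral>\<^sup>+ w. (\<integral>\<^sup>+ q. \<Phi> q (S q w) \<partial>lborel) \<partial>lborel) = (\<integral>\<^sup>+ q. (\<integral>\<^sup>+ w. \<Phi> q (S q w) \<partial>lborel) \<partial>lborel)"
    by (rule lborel_pair.Fubini'[symmetric]) (use m1 in \<open>simp add: lborel_prod\<close>)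
  also have "\<dots> = (\<integral>\<^sup>+ w. (\<integral>\<^sup>+ q. \<Phi> q w \<partial>lborel) \<partial>lborel)"
    unfolding S by (rule lborel_pair.Fubini') (use m2 in \<open>simp add: lborel_prod\<close>)
  finally show ?thesis .
qed

lemma nn_integral_lborel_pair:
  fixes f :: "'a::euclidean_space \<Rightarrow> 'b::euclidean_space \<Rightarrow> ennreal"
  assumes "(\<lambda>q. f (fst q) (snd q)) \<in> borel_measurable borel"
  shows "(\<integral>\<^sup>+ q. f (fst q) (snd q) \<partial>lborel) = (\<integral>\<^sup>+ x. (\<integral>\<^sup>+ y. f x y \<partial>lborel) \<partial>lborel)"
  using lborel.nn_integral_fst[of "\<lambda>q. f (fst q) (snd q)" lborel] assms by (simp add: lborel_prod)

section \<open>Bounds for the derivatives by the function\<close>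

text \<open>
  The order of \<open>\<L>\<^sub>j\<close> in terms of powers of \<open>\<rho>\<close>: the contribution of the index \<open>j\<close> to \<open>\<langle>\<alpha>\<rangle>\<close>.
\<close>

definition tangent_order :: "'n::{finite,linorder} \<Rightarrow> real" where
  "tangent_order j = (if j = last_index then 1 else 1 / 2)"

definition bergman_integral ::
  "real \<Rightarrow> real \<Rightarrow> (complex ^ 'n::{finite,linorder} \<Rightarrow> complex) \<Rightarrow> ennreal" where
  "bergman_integral p s g =
     (\<integral>\<^sup>+ z. indicator siegel_domain z * ennreal (cmod (g z) powr p * siegel_rho z powr s) \<partial>lborel)"

lemma siegel_rho_tangent_pos:
  fixes w :: "complex ^ 'n::{finite,linorder}"
  assumes w: "0 < siegel_rho w" and z: "cmod \<zeta> < siegel_rho w powr tangent_order j"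
  shows "0 < siegel_rho (w + \<zeta> *s tangent_vec j (cnj (w $ j)))"
proof (cases "j = last_index")
  case True
  then show ?thesis
    using z w abs_Im_le_cmod[of \<zeta>] by (simp add: siegel_rho_add_tangent tangent_order_def)
next
  case False
  then have "cmod \<zeta> < sqrt (siegel_rho w)"
    using z w by (simp add: tangent_order_def powr_half_sqrt)
  then have "(cmod \<zeta>)\<^sup>2 < siegel_rho w"
    using w by (metis norm_ge_zero real_sqrt_less_iff real_sqrt_unique)
  then show ?thesis using False by (simp add: siegel_rho_add_tangent)
qed

text \<open>
  Besides the comparability of \<open>\<rho>\<close> at the two points, the last claim bounds the radius by the value of
  \<open>\<rho>\<close> at the shifted point. It is what remains of the condition on the radius once the shifted point has
  become the variable of integration.
\<close>

lemma siegel_rho_tangent_comparable: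
  fixes w :: "complex ^ 'n::{finite,linorder}"
  assumes w: "0 < siegel_rho w" and z: "cmod \<zeta> \<le> siegel_rho w powr tangent_order j / 2"
  defines "y \<equiv> siegel_rho (w + \<zeta> *s tangent_vec j (cnj (w $ j)))"
  shows "siegel_rho w / 2 \<le> y" "y \<le> 2 * siegel_rho w" "cmod \<zeta> \<le> y powr tangent_order j"
proof -
  have "siegel_rho w / 2 \<le> y \<and> y \<le> 2 * siegel_rho w \<and> cmod \<zeta> \<le> y powr tangent_order j"
  proof (cases "j = last_index")
    case True
    then have 1: "cmod \<zeta> \<le> siegel_rho w / 2" "y = siegel_rho w + Im \<zeta>"
      using z w by (auto simp: y_def tangent_order_def siegel_rho_add_tangent)
    moreover from this have "y powr tangent_order j = y"
      using True w abs_Im_le_cmod[of \<zeta>] by (simp add: tangent_order_def)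
    ultimately show ?thesis using w abs_Im_le_cmod[of \<zeta>] by linarith
  next
    case False
    then have "cmod \<zeta> \<le> sqrt (siegel_rho w) / 2"
      using z w by (simp add: tangent_order_def powr_half_sqrt)
    then have "(cmod \<zeta>)\<^sup>2 \<le> (sqrt (siegel_rho w) / 2)\<^sup>2" by (intro power_mono) auto
    then have 2: "(cmod \<zeta>)\<^sup>2 \<le> siegel_rho w / 4" using w by (simp add: power_divide)
    have 1: "y = siegel_rho w - (cmod \<zeta>)\<^sup>2" using False by (simp add: y_def siegel_rho_add_tangent)
    have "cmod \<zeta> \<le> sqrt y" using 1 2 w by (intro real_le_rsqrt) simp
    moreover have "0 \<le> (cmod \<zeta>)\<^sup>2" by simp
    moreover have "y powr tangent_order j = sqrt y"
      using 1 2 w False by (simp add: tangent_order_def powr_half_sqrt)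
    ultimately show ?thesis using 1 2 w by linarith
  qed
  then show "siegel_rho w / 2 \<le> y" "y \<le> 2 * siegel_rho w" "cmod \<zeta> \<le> y powr tangent_order j" by auto
qed

lemma powr_comparable:
  fixes x y e :: real
  assumes "0 < x" "x / 2 \<le> y" "y \<le> 2 * x"
  shows "x powr e \<le> 2 powr \<bar>e\<bar> * y powr e"
proof (cases "0 \<le> e")
  case True
  have "x powr e \<le> (2 * y) powr e" using assms True by (intro powr_mono2) auto
  then show ?thesis using assms True by (simp add: powr_mult)
next
  case False
  have "x powr e \<le> (y / 2) powr e" using assms False by (intro powr_mono2') auto
  also have "\<dots> = 2 powr \<bar>e\<bar> * y powr e"
    using assms False by (simp add: powr_divide powr_minus field_simps)
  finally show ?thesis .
qed

lemma continuous_on_tangent_shift: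
  "continuous_on UNIV (\<lambda>(w :: complex ^ 'n::{finite,linorder}, q :: real \<times> real).
     w + (complex_of_real (fst q) * cis (2 * pi * snd q)) *s tangent_vec j (cnj (w $ j)))"
proof -
  have "continuous_on UNIV (\<lambda>x :: (complex, 'n) vec \<times> (real \<times> real). \<chi> k. fst x $ k +
      (complex_of_real (fst (snd x)) * cis (2 * pi * snd (snd x))) *
      ((if k = j then 1 else 0) + (if k = last_index then tangent_coeff j (cnj (fst x $ j)) else 0)))"
  proof (intro continuous_on_vec_lambda continuous_on_add continuous_on_mult)
    show "continuous_on UNIV (\<lambda>x :: (complex, 'n) vec \<times> (real \<times> real).
        if k = last_index then tangent_coeff j (cnj (fst x $ j)) else 0)" for k
      by (cases "k = last_index"; cases "j = last_index")
        (auto simp: tangent_coeff_def intro!: continuous_intros)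
  qed (auto intro!: continuous_intros)
  also have "(\<lambda>x :: (complex, 'n) vec \<times> (real \<times> real). \<chi> k. fst x $ k +
      (complex_of_real (fst (snd x)) * cis (2 * pi * snd (snd x))) *
      ((if k = j then 1 else 0) + (if k = last_index then tangent_coeff j (cnj (fst x $ j)) else 0)))
    = (\<lambda>(w, q). w + (complex_of_real (fst q) * cis (2 * pi * snd q)) *s tangent_vec j (cnj (w $ j)))"
    by (auto simp: fun_eq_iff vec_eq_iff tangent_vec_def axis_def distrib_left)
  finally show ?thesis .
qed

lemma measurable_siegel_rho [measurable]: "siegel_rho \<in> borel_measurable borel"
  by (rule borel_measurable_continuous_onI[OF continuous_siegel_rho])

lemma measurable_indicator_powr:
  fixes g :: "complex ^ 'n::{finite,linorder} \<Rightarrow> complex"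
  assumes "continuous_on siegel_domain g" "0 < p"
  shows "(\<lambda>z. indicator siegel_domain z * ennreal (cmod (g z) powr p)) \<in> borel_measurable borel"
proof -
  have "continuous_on siegel_domain (\<lambda>z. cmod (g z) powr p)"
    using assms by (intro continuous_on_powr' continuous_on_norm continuous_on_const) auto
  then have "(\<lambda>z. indicator siegel_domain z *\<^sub>R (cmod (g z) powr p)) \<in> borel_measurable borel"
    by (intro borel_measurable_continuous_on_indicator) (simp add: open_siegel_domain borel_open)
  then have "(\<lambda>z. ennreal (indicator siegel_domain z *\<^sub>R (cmod (g z) powr p))) \<in> borel_measurable borel"
    by measurable
  also have "(\<lambda>z. ennreal (indicator siegel_domain z *\<^sub>R (cmod (g z) powr p))) =
     (\<lambda>z. indicator siegel_domain z * ennreal (cmod (g z) powr p))"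
    by (auto simp: indicator_def fun_eq_iff)
  finally show ?thesis .
qed

text \<open>
  The radius \<open>r\<close> is an additional variable of integration: as the admissible radii depend on \<open>w\<close>, this
  leaves shears with a fixed \<open>\<zeta>\<close>, for which the volume is known to be preserved. The interval of
  admissible radii has length \<open>R / 4\<close>, which accounts for the factor \<open>4\<close> and for the exponent \<open>s - \<sigma>\<close> of
  \<open>\<rho>\<close> inside the mean; integrating \<open>r\<close> over \<open>{0..R}\<close> at the shifted point restores the exponent \<open>s\<close>.
\<close>

lemma siegel_L_power_integral_bound:
  fixes g :: "complex ^ 'n::{finite,linorder} \<Rightarrow> complex"
  assumes p: "1 \<le> p" and g: "conj_holomorphic siegel_domain S g" and j: "j \<notin> S" "last_index \<notin> S"
  shows "bergman_integral p (s + p * (tangent_order j * a)) ((siegel_L j ^^ a) g) \<le>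
     ennreal (4 * ((4 ^ a * fact a) powr p * 2 powr \<bar>s - tangent_order j\<bar>)) * bergman_integral p s g"
proof -
  let ?U = "siegel_domain :: (complex, 'n) vec set"
  define \<sigma> where "\<sigma> = tangent_order j"
  define e where "e = s - \<sigma>"
  define K where "K = (4 ^ a * fact a :: real) powr p * 2 powr \<bar>e\<bar>"
  define G where "G = (\<lambda>z. indicator ?U z * ennreal (cmod (g z) powr p))"
  define shift where "shift = (\<lambda>(q :: real \<times> real) (w :: (complex, 'n) vec).
    w + (complex_of_real (fst q) * cis (2 * pi * snd q)) *s tangent_vec j (cnj (w $ j)))"
  \<comment> \<open>The parameter is \<open>q = (r, t)\<close>, for the point \<open>r exp(2 \<pi> \<i> t)\<close> of the circle of radius \<open>r\<close>.\<close>
  define \<Phi> where "\<Phi> = (\<lambda>(q :: real \<times> real) z. (if 0 \<le> fst q \<and> fst q \<le> siegel_rho z powr \<sigma> then 1 else 0) *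
    indicator {0..1} (snd q) * (G z * ennreal (siegel_rho z powr e)))"
  have gc: "continuous_on ?U g" by (rule conj_holomorphic_continuous_on[OF open_siegel_domain g])
  have G[measurable]: "G \<in> borel_measurable borel"
    unfolding G_def using p by (intro measurable_indicator_powr gc) simp
  have shift[measurable]: "(\<lambda>x. shift (snd x) (fst x)) \<in> borel_measurable borel"
    using borel_measurable_continuous_onI[OF continuous_on_tangent_shift[of j]]
    by (simp add: shift_def case_prod_unfold)
  have \<Phi>: "(\<lambda>x. \<Phi> (snd x) (fst x)) \<in> borel_measurable borel"
  proof -
    have "(\<lambda>x. \<Phi> (snd x) (fst x)) \<in> borel_measurable (borel \<Otimes>\<^sub>M (borel \<Otimes>\<^sub>M borel))"
      unfolding \<Phi>_def by measurable
    then show ?thesis by (simp add: borel_prod)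
  qed
  have pair_m: "(\<lambda>x. (shift (snd x) (fst x), snd x)) \<in> (borel :: ((complex, 'n) vec \<times> (real \<times> real)) measure) \<rightarrow>\<^sub>M borel"
    by (intro borel_measurable_Pair shift borel_measurable_continuous_onI continuous_intros)
  have \<Phi>shift: "(\<lambda>x. \<Phi> (snd x) (shift (snd x) (fst x))) \<in> borel_measurable borel"
    using measurable_compose[OF pair_m \<Phi>] by simp
  have \<Phi>q: "\<Phi> q \<in> borel_measurable borel" for q
    unfolding \<Phi>_def by measurable
  have pointwise: "indicator ?U w * ennreal (cmod ((siegel_L j ^^ a) g w) powr p * siegel_rho w powr (s + p * (\<sigma> * a)))
     \<le> ennreal (4 * K) * (\<integral>\<^sup>+ q. \<Phi> q (shift q w) \<partial>lborel)" for w
  proof (cases "w \<in> ?U")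
    case False
    then show ?thesis by simp
  next
    case True
    then have \<rho>: "0 < siegel_rho w" by (simp add: siegel_domain_eq)
    define R where "R = siegel_rho w powr \<sigma>"
    define L where "L = cmod ((siegel_L j ^^ a) g w)"
    define E where "E = L powr p * siegel_rho w powr (e + p * (\<sigma> * a))"
    have R: "0 < R" using \<rho> by (simp add: R_def)
    \<comment> \<open>The estimate on a single circle; \<open>E\<close> is the integrand of the claim divided by \<open>R\<close>.\<close>
    have circ: "ennreal E \<le> ennreal K * (\<integral>\<^sup>+ t. \<Phi> (r, t) (shift (r, t) w) \<partial>lborel)"
      if r: "r \<in> {R / 4..R / 2}" for r
    proof -
      define h where "h = (\<lambda>t. cmod (g (shift (r, t) w)))"
      have inU: "w + \<zeta> *s tangent_vec j (cnj (w $ j)) \<in> ?U" if "\<zeta> \<in> ball 0 R" for \<zeta>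
        using siegel_rho_tangent_pos[OF \<rho>, of \<zeta> j] that by (simp add: siegel_domain_eq R_def \<sigma>_def)
      have r': "0 < r" "r < R" using r R by auto
      have hc: "continuous_on {0..1} h" "L * r ^ a \<le> fact a * integral {0..1} h"
        using siegel_L_power_circle_bound[OF open_siegel_domain g j inU r'] by (simp_all add: h_def shift_def L_def)
      have h0: "0 \<le> h t" for t by (simp add: h_def)
      have I0: "0 \<le> integral {0..1} h"
        by (rule integral_nonneg[OF integrable_continuous_interval[OF hc(1)]]) (simp add: h0)
      have "L * R ^ a \<le> L * (4 * r) ^ a"
        using r R by (intro mult_left_mono power_mono) (auto simp: L_def)
      also have "\<dots> = 4 ^ a * (L * r ^ a)" by (simp add: power_mult_distrib)
      also have "\<dots> \<le> 4 ^ a * (fact a * integral {0..1} h)" by (intro mult_left_mono hc(2)) simp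
      finally have "(L * R ^ a) powr p \<le> (4 ^ a * fact a * integral {0..1} h) powr p"
        using p R by (intro powr_mono2) (auto simp: L_def)
      moreover have "(L * R ^ a) powr p = L powr p * siegel_rho w powr (p * (\<sigma> * a))"
        using R \<rho> by (simp add: powr_mult L_def R_def powr_powr powr_realpow[symmetric] mult_ac)
      moreover have "(4 ^ a * fact a * integral {0..1} h) powr p =
          (4 ^ a * fact a) powr p * integral {0..1} h powr p"
        using I0 by (simp add: powr_mult)
      ultimately have LE: "L powr p * siegel_rho w powr (p * (\<sigma> * a)) \<le>
          (4 ^ a * fact a) powr p * integral {0..1} h powr p" by simp
      have "E = siegel_rho w powr e * (L powr p * siegel_rho w powr (p * (\<sigma> * a)))"
        by (simp add: E_def powr_add)
      also have "\<dots> \<le> siegel_rho w powr e * ((4 ^ a * fact a) powr p * integral {0..1} h powr p)"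
        by (intro mult_left_mono LE) simp
      also have "\<dots> = (siegel_rho w powr e * (4 ^ a * fact a) powr p) * integral {0..1} h powr p"
        by simp
      finally have "ennreal E \<le> ennreal (siegel_rho w powr e * (4 ^ a * fact a) powr p) * ennreal (integral {0..1} h powr p)"
        by (subst ennreal_mult[symmetric]) (auto intro!: ennreal_leI)
      also have "\<dots> \<le> ennreal (siegel_rho w powr e * (4 ^ a * fact a) powr p) *
          (\<integral>\<^sup>+ t. indicator {0..1} t * ennreal (h t powr p) \<partial>lborel)"
        by (intro mult_left_mono nn_integral_powr_Jensen p hc(1) h0) simp
      also have "\<dots> = (\<integral>\<^sup>+ t. ennreal (siegel_rho w powr e * (4 ^ a * fact a) powr p) *
          (indicator {0..1} t * ennreal (h t powr p)) \<partial>lborel)"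
      proof (rule nn_integral_cmult[symmetric])
        have "continuous_on {0..1} (\<lambda>t. h t powr p)"
          using p h0 by (intro continuous_on_powr' hc(1) continuous_on_const) auto
        then have "(\<lambda>t. ennreal (indicator {0..1} t *\<^sub>R (h t powr p))) \<in> borel_measurable borel"
          by (intro measurable_compose[OF borel_measurable_continuous_on_indicator measurable_ennreal]) auto
        also have "(\<lambda>t. ennreal (indicator {0..1} t *\<^sub>R (h t powr p))) =
           (\<lambda>t. indicator {0..1} t * ennreal (h t powr p))"
          by (auto simp: indicator_def fun_eq_iff)
        finally show "(\<lambda>t. indicator {0..1} t * ennreal (h t powr p)) \<in> borel_measurable lborel" by simp
      qed
      also have "\<dots> \<le> (\<integral>\<^sup>+ t. ennreal K * \<Phi> (r, t) (shift (r, t) w) \<partial>lborel)"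
      proof (rule nn_integral_mono)
        fix t :: real
        have nz: "cmod (complex_of_real r * cis (2 * pi * t)) = r" using r' by (simp add: norm_mult)
        have zle: "cmod (complex_of_real r * cis (2 * pi * t)) \<le> siegel_rho w powr tangent_order j / 2"
          using r unfolding nz by (simp add: R_def \<sigma>_def)
        note cmp = siegel_rho_tangent_comparable[OF \<rho> zle]
        have y: "siegel_rho w / 2 \<le> siegel_rho (shift (r, t) w)" "siegel_rho (shift (r, t) w) \<le> 2 * siegel_rho w"
          "r \<le> siegel_rho (shift (r, t) w) powr \<sigma>"
          using cmp unfolding nz by (simp_all add: shift_def \<sigma>_def)
        have "shift (r, t) w \<in> ?U" using y(1) \<rho> by (simp add: siegel_domain_eq)
        then have \<Phi>e: "\<Phi> (r, t) (shift (r, t) w) = indicator {0..1} t * ennreal (h t powr p * siegel_rho (shift (r, t) w) powr e)"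
          using y(3) r' by (simp add: \<Phi>_def G_def h_def ennreal_mult)
        have "siegel_rho w powr e * (4 ^ a * fact a) powr p * h t powr p \<le>
            (2 powr \<bar>e\<bar> * siegel_rho (shift (r, t) w) powr e) * (4 ^ a * fact a) powr p * h t powr p"
          by (intro mult_right_mono powr_comparable \<rho> y) auto
        also have "\<dots> = K * (h t powr p * siegel_rho (shift (r, t) w) powr e)" by (simp add: K_def)
        finally show "ennreal (siegel_rho w powr e * (4 ^ a * fact a) powr p) *
          (indicator {0..1} t * ennreal (h t powr p)) \<le> ennreal K * \<Phi> (r, t) (shift (r, t) w)"
          unfolding \<Phi>e by (auto simp: indicator_def ennreal_mult[symmetric] K_def intro!: ennreal_leI)
      qed
      also have "\<dots> = ennreal K * (\<integral>\<^sup>+ t. \<Phi> (r, t) (shift (r, t) w) \<partial>lborel)"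
      proof (rule nn_integral_cmult)
        have "(\<lambda>t. (w, (r, t))) \<in> borel \<rightarrow>\<^sub>M borel"
          by (intro borel_measurable_continuous_onI continuous_intros)
        from measurable_compose[OF this \<Phi>shift] show "(\<lambda>t. \<Phi> (r, t) (shift (r, t) w)) \<in> borel_measurable lborel"
          by simp
      qed
      finally show ?thesis .
    qed
    have mq: "(\<lambda>q. \<Phi> q (shift q w)) \<in> borel_measurable borel"
    proof -
      have "(\<lambda>q. (w, q)) \<in> (borel :: (real \<times> real) measure) \<rightarrow>\<^sub>M borel"
        by (intro borel_measurable_continuous_onI continuous_intros)
      from measurable_compose[OF this \<Phi>shift] show ?thesis by simp
    qed
    have "ennreal (L powr p * siegel_rho w powr (s + p * (\<sigma> * a))) = ennreal (4 * (E * (R / 4)))"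
      using \<rho> by (simp add: E_def e_def R_def mult.assoc powr_add[symmetric] algebra_simps)
    also have "\<dots> = ennreal 4 * (ennreal E * ennreal (R / 4))"
      by (subst ennreal_mult', simp, subst ennreal_mult') (simp_all add: E_def)
    also have "ennreal E * ennreal (R / 4) = (\<integral>\<^sup>+ r. ennreal E * indicator {R / 4..R / 2} r \<partial>lborel)"
      using R by (subst nn_integral_cmult_indicator) (auto simp: field_simps)
    also have "\<dots> \<le> (\<integral>\<^sup>+ r. ennreal K * (\<integral>\<^sup>+ t. \<Phi> (r, t) (shift (r, t) w) \<partial>lborel) \<partial>lborel)"
      by (rule nn_integral_mono) (use circ in \<open>auto simp: indicator_def\<close>)
    also have "\<dots> = ennreal K * (\<integral>\<^sup>+ r. (\<integral>\<^sup>+ t. \<Phi> (r, t) (shift (r, t) w) \<partial>lborel) \<partial>lborel)"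
    proof (rule nn_integral_cmult)
      show "(\<lambda>r. \<integral>\<^sup>+ t. \<Phi> (r, t) (shift (r, t) w) \<partial>lborel) \<in> borel_measurable lborel"
        by (rule lborel.borel_measurable_nn_integral_fst[of "\<lambda>q. \<Phi> q (shift q w)"]) (use mq in \<open>simp add: lborel_prod\<close>)
    qed
    also have "(\<integral>\<^sup>+ r. (\<integral>\<^sup>+ t. \<Phi> (r, t) (shift (r, t) w) \<partial>lborel) \<partial>lborel) = (\<integral>\<^sup>+ q. \<Phi> q (shift q w) \<partial>lborel)"
      using nn_integral_lborel_pair[of "\<lambda>r t. \<Phi> (r, t) (shift (r, t) w)"] mq by simp
    finally show ?thesis
      using True by (simp add: L_def ennreal_mult K_def mult.assoc mult_left_mono)
  qed
  \<comment> \<open>Integrating out the parameter at the shifted point gives back the integrand for \<open>g\<close>.\<close>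
  have radial: "(\<integral>\<^sup>+ q. \<Phi> q w \<partial>lborel) = indicator ?U w * ennreal (cmod (g w) powr p * siegel_rho w powr s)" for w
  proof (cases "w \<in> ?U")
    case False
    then show ?thesis by (simp add: \<Phi>_def G_def)
  next
    case True
    then have \<rho>: "0 < siegel_rho w" by (simp add: siegel_domain_eq)
    have mq: "(\<lambda>q. \<Phi> q w) \<in> borel_measurable borel"
    proof -
      have "(\<lambda>q. (w, q)) \<in> (borel :: (real \<times> real) measure) \<rightarrow>\<^sub>M borel"
        by (intro borel_measurable_continuous_onI continuous_intros)
      from measurable_compose[OF this \<Phi>] show ?thesis by simp
    qed
    let ?c = "G w * ennreal (siegel_rho w powr e)"
    have "(\<integral>\<^sup>+ q. \<Phi> q w \<partial>lborel) = (\<integral>\<^sup>+ r. (\<integral>\<^sup>+ t. \<Phi> (r, t) w \<partial>lborel) \<partial>lborel)"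
      using nn_integral_lborel_pair[of "\<lambda>r t. \<Phi> (r, t) w"] mq by simp
    also have "\<dots> = (\<integral>\<^sup>+ r. (\<integral>\<^sup>+ t. (indicator {0..siegel_rho w powr \<sigma>} r * ?c) * indicator {0..1::real} t \<partial>lborel) \<partial>lborel)"
      by (intro nn_integral_cong) (auto simp: \<Phi>_def indicator_def mult_ac)
    also have "\<dots> = (\<integral>\<^sup>+ r. ?c * indicator {0..siegel_rho w powr \<sigma>} r \<partial>lborel)"
      by (subst nn_integral_cmult_indicator) (auto simp: mult.commute)
    also have "\<dots> = ?c * ennreal (siegel_rho w powr \<sigma>)"
      by (subst nn_integral_cmult_indicator) auto
    also have "\<dots> = ennreal (cmod (g w) powr p * siegel_rho w powr s)"
      using True by (simp add: G_def ennreal_mult[symmetric] mult.assoc powr_add[symmetric] e_def)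
    finally show ?thesis using True by simp
  qed
  have mw: "(\<lambda>w. \<integral>\<^sup>+ q. \<Phi> q (shift q w) \<partial>lborel) \<in> borel_measurable lborel"
    using lborel.borel_measurable_nn_integral_fst[of "\<lambda>x. \<Phi> (snd x) (shift (snd x) (fst x))" lborel] \<Phi>shift
    by (simp add: lborel_prod)
  have "bergman_integral p (s + p * (\<sigma> * a)) ((siegel_L j ^^ a) g) \<le>
     (\<integral>\<^sup>+ w. ennreal (4 * K) * (\<integral>\<^sup>+ q. \<Phi> q (shift q w) \<partial>lborel) \<partial>lborel)"
    unfolding bergman_integral_def by (intro nn_integral_mono pointwise)
  also have "\<dots> = ennreal (4 * K) * (\<integral>\<^sup>+ w. (\<integral>\<^sup>+ q. \<Phi> q (shift q w) \<partial>lborel) \<partial>lborel)"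
    by (rule nn_integral_cmult[OF mw])
  also have "(\<integral>\<^sup>+ w. (\<integral>\<^sup>+ q. \<Phi> q (shift q w) \<partial>lborel) \<partial>lborel) = (\<integral>\<^sup>+ w. (\<integral>\<^sup>+ q. \<Phi> q w \<partial>lborel) \<partial>lborel)"
  proof (rule nn_integral_average_shift)
    show "(\<integral>\<^sup>+ w. \<Phi> q (shift q w) \<partial>lborel) = (\<integral>\<^sup>+ w. \<Phi> q w \<partial>lborel)" for q
      unfolding shift_def by (rule nn_integral_tangent_shift[OF \<Phi>q])
  qed (use \<Phi> \<Phi>shift in \<open>simp_all add: case_prod_unfold\<close>)
  also have "\<dots> = bergman_integral p s g"
    unfolding radial bergman_integral_def ..
  finally show ?thesis by (simp add: \<sigma>_def K_def e_def)
qed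

section \<open>Bounds for the function by its last derivative\<close>

text \<open>
  These maps move each point along the line in direction \<open>\<i> e\<^sub>n\<close>, on which they scale \<open>\<rho>\<close> by the factor
  \<open>c\<close>.
\<close>

definition siegel_dilate :: "real \<Rightarrow> complex ^ 'n::{finite,linorder} \<Rightarrow> complex ^ 'n::{finite,linorder}" where
  "siegel_dilate c z = z + ((c - 1) * siegel_rho z) *\<^sub>R axis last_index \<i>"

lemma siegel_rho_dilate: "siegel_rho (siegel_dilate c z) = c * siegel_rho z"
proof -
  have "(\<Sum>j\<in>UNIV - {last_index}. (cmod (siegel_dilate c z $ j))\<^sup>2) = (\<Sum>j\<in>UNIV - {last_index}. (cmod (z $ j))\<^sup>2)"
    by (intro sum.cong) (auto simp: siegel_dilate_def axis_def)
  moreover have "Im (siegel_dilate c z $ last_index) = Im (z $ last_index) + (c - 1) * siegel_rho z"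
    by (simp add: siegel_dilate_def)
  ultimately have "siegel_rho (siegel_dilate c z) = siegel_rho z + (c - 1) * siegel_rho z"
    by (simp add: siegel_rho_def)
  then show ?thesis by (simp add: algebra_simps)
qed

lemma siegel_dilate_mem_iff: "0 < c \<Longrightarrow> siegel_dilate c z \<in> siegel_domain \<longleftrightarrow> z \<in> siegel_domain"
  by (simp add: siegel_domain_eq siegel_rho_dilate zero_less_mult_iff)

lemma continuous_on_siegel_dilate:
  assumes "continuous_on A f" "continuous_on A h"
  shows "continuous_on A (\<lambda>x. siegel_dilate (f x) (h x))"
  unfolding siegel_dilate_def
  by (intro continuous_intros assms continuous_on_compose2[OF continuous_siegel_rho assms(2)]) auto

lemma nn_integral_siegel_dilate:
  fixes F :: "complex ^ 'n::{finite,linorder} \<Rightarrow> ennreal"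
  assumes F: "F \<in> borel_measurable borel" and c: "0 < c"
  shows "(\<integral>\<^sup>+ z. F z \<partial>lborel) = ennreal c * (\<integral>\<^sup>+ z. F (siegel_dilate c z) \<partial>lborel)"
proof -
  let ?b = "axis last_index \<i> :: (complex, 'n) vec"
  let ?k = "\<lambda>z :: (complex, 'n) vec. - ((c - 1) * (\<Sum>j\<in>UNIV - {last_index}. (cmod (z $ j))\<^sup>2))"
  have "?k \<in> borel_measurable borel"
    by (intro borel_measurable_continuous_onI continuous_intros)
  moreover have "?k (z + s *\<^sub>R ?b) = ?k z" for z s
  proof -
    have "(\<Sum>j\<in>UNIV - {last_index}. (cmod ((z + s *\<^sub>R ?b) $ j))\<^sup>2) = (\<Sum>j\<in>UNIV - {last_index}. (cmod (z $ j))\<^sup>2)"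
      by (intro sum.cong) (auto simp: axis_def)
    then show ?thesis by simp
  qed
  moreover have "?b \<in> Basis" by (simp add: Basis_complex_def)
  ultimately have "(\<integral>\<^sup>+ z. F z \<partial>lborel) = ennreal c * (\<integral>\<^sup>+ z. F (z + (?k z + (c - 1) * (z \<bullet> ?b)) *\<^sub>R ?b) \<partial>lborel)"
    using nn_integral_lborel_coordinate_affine[OF F, of ?b ?k c] c by blast
  moreover have "z + (?k z + (c - 1) * (z \<bullet> ?b)) *\<^sub>R ?b = siegel_dilate c z" for z
    by (simp add: siegel_dilate_def siegel_rho_def inner_axis inner_complex_def algebra_simps)
  ultimately show ?thesis by (simp only:)
qed

lemma measurable_bergman_integrand:
  fixes g :: "complex ^ 'n::{finite,linorder} \<Rightarrow> complex"
  assumes "continuous_on siegel_domain g" "0 < p"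
  shows "(\<lambda>z. indicator siegel_domain z * ennreal (cmod (g z) powr p * siegel_rho z powr s)) \<in> borel_measurable borel"
proof -
  have "(\<lambda>z. (indicator siegel_domain z * ennreal (cmod (g z) powr p)) * ennreal (siegel_rho z powr s)) \<in> borel_measurable borel"
    using measurable_indicator_powr[OF assms] by measurable
  then show ?thesis by (simp add: ennreal_mult mult.assoc)
qed

lemma bergman_integral_siegel_dilate:
  fixes g :: "complex ^ 'n::{finite,linorder} \<Rightarrow> complex"
  assumes g: "continuous_on siegel_domain g" and p: "0 < p" and c: "0 < c"
  shows "bergman_integral p s g = ennreal (c powr (s + 1)) * bergman_integral p s (\<lambda>z. g (siegel_dilate c z))"
proof -
  let ?U = "siegel_domain :: (complex, 'n) vec set"
  have gd: "continuous_on ?U (\<lambda>z. g (siegel_dilate c z))"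
    by (rule continuous_on_compose2[OF g continuous_on_siegel_dilate[OF continuous_on_const continuous_on_id]])
      (auto simp: siegel_dilate_mem_iff c)
  have "bergman_integral p s g = ennreal c * (\<integral>\<^sup>+ z. indicator ?U (siegel_dilate c z) *
      ennreal (cmod (g (siegel_dilate c z)) powr p * siegel_rho (siegel_dilate c z) powr s) \<partial>lborel)"
    unfolding bergman_integral_def
    by (rule nn_integral_siegel_dilate[OF measurable_bergman_integrand[OF g p] c])
  also have "(\<integral>\<^sup>+ z. indicator ?U (siegel_dilate c z) *
      ennreal (cmod (g (siegel_dilate c z)) powr p * siegel_rho (siegel_dilate c z) powr s) \<partial>lborel)
    = (\<integral>\<^sup>+ z. ennreal (c powr s) * (indicator ?U z * ennreal (cmod (g (siegel_dilate c z)) powr p * siegel_rho z powr s)) \<partial>lborel)"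
  proof (rule nn_integral_cong)
    fix z :: "(complex, 'n) vec"
    show "indicator ?U (siegel_dilate c z) *
        ennreal (cmod (g (siegel_dilate c z)) powr p * siegel_rho (siegel_dilate c z) powr s) =
      ennreal (c powr s) * (indicator ?U z * ennreal (cmod (g (siegel_dilate c z)) powr p * siegel_rho z powr s))"
    proof (cases "z \<in> ?U")
      case True
      then have "0 < siegel_rho z" by (simp add: siegel_domain_eq)
      then show ?thesis using True c
        by (simp add: siegel_dilate_mem_iff siegel_rho_dilate powr_mult ennreal_mult[symmetric] mult_ac)
    qed (simp add: siegel_dilate_mem_iff c)
  qed
  also have "\<dots> = ennreal (c powr s) * bergman_integral p s (\<lambda>z. g (siegel_dilate c z))"
    unfolding bergman_integral_def
    using measurable_bergman_integrand[OF gd p] by (intro nn_integral_cmult) simp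
  finally show ?thesis
    using c by (simp add: powr_add ennreal_mult mult_ac)
qed

lemma siegel_dilate_increment:
  fixes g :: "complex ^ 'n::{finite,linorder} \<Rightarrow> complex"
  assumes g: "conj_holomorphic siegel_domain {} g" and z: "z \<in> siegel_domain"
  shows "continuous_on {0..1} (\<lambda>t. siegel_rho z * cmod (siegel_L last_index g (siegel_dilate (1 + t) z)))"
    and "cmod (g z) \<le> cmod (g (siegel_dilate 2 z)) +
      integral {0..1} (\<lambda>t. siegel_rho z * cmod (siegel_L last_index g (siegel_dilate (1 + t) z)))"
proof -
  let ?L = "siegel_L last_index g"
  have \<rho>: "0 < siegel_rho z" using z by (simp add: siegel_domain_eq)
  have Lc: "continuous_on siegel_domain ?L"
    by (rule conj_holomorphic_continuous_on[OF open_siegel_domain conj_holomorphic_siegel_L[OF open_siegel_domain g]]) simp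
  have mem: "siegel_dilate (1 + t) z \<in> siegel_domain" if "t \<in> {0..1}" for t
    using that z by (simp add: siegel_dilate_mem_iff)
  have path: "continuous_on {0..1} (\<lambda>t. siegel_dilate (1 + t) z)"
    by (intro continuous_on_siegel_dilate continuous_on_add continuous_on_const continuous_on_id)
  have Ld: "continuous_on {0..1} (\<lambda>t. ?L (siegel_dilate (1 + t) z))"
    by (rule continuous_on_compose2[OF Lc path]) (use mem in auto)
  show cont: "continuous_on {0..1} (\<lambda>t. siegel_rho z * cmod (?L (siegel_dilate (1 + t) z)))"
    by (intro continuous_intros Ld)
  have dil: "siegel_dilate (1 + t) z = z + (\<i> * (siegel_rho z * t)) *s tangent_vec last_index b" for t b
    by (simp add: siegel_dilate_def vec_eq_iff axis_def tangent_vec_def tangent_coeff_def complex_eq_iff)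
  have deriv: "((\<lambda>t. g (siegel_dilate (1 + t) z)) has_vector_derivative
      \<i> * siegel_rho z * ?L (siegel_dilate (1 + t) z)) (at t within {0..1})" if t: "t \<in> {0..1}" for t
  proof -
    let ?\<zeta> = "\<i> * (siegel_rho z * t)"
    have "((\<lambda>\<zeta>. g (z + \<zeta> *s tangent_vec last_index 0)) has_field_derivative
       tangent_deriv last_index 0 g (z + ?\<zeta> *s tangent_vec last_index 0)) (at ?\<zeta>)"
      by (rule tangent_slice_has_derivative[OF open_siegel_domain g]) (use mem[OF t] in \<open>simp_all add: dil[of _ 0]\<close>)
    also have "tangent_deriv last_index 0 g (z + ?\<zeta> *s tangent_vec last_index 0) = ?L (siegel_dilate (1 + t) z)"
      by (simp add: dil[of _ 0] siegel_L_eq_tangent_deriv tangent_deriv_def tangent_coeff_def)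
    finally have d: "((\<lambda>\<zeta>. g (z + \<zeta> *s tangent_vec last_index 0)) has_field_derivative
       ?L (siegel_dilate (1 + t) z)) (at ?\<zeta>)" .
    have "((\<lambda>t. \<i> * (complex_of_real (siegel_rho z * t))) has_vector_derivative \<i> * siegel_rho z) (at t within {0..1})"
      by (auto intro!: derivative_eq_intros simp: has_vector_derivative_def scaleR_conv_of_real)
    from field_vector_diff_chain_within[OF this has_field_derivative_at_within[OF d]]
    show ?thesis by (simp add: o_def dil[of _ 0])
  qed
  have d1: "siegel_dilate 1 z = z" by (simp add: siegel_dilate_def)
  from fundamental_theorem_of_calculus[OF _ deriv]
  have "((\<lambda>t. \<i> * siegel_rho z * ?L (siegel_dilate (1 + t) z)) has_integral
      g (siegel_dilate (1 + 1) z) - g (siegel_dilate (1 + 0) z)) {0..1}" by simp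
  then have ftc: "integral {0..1} (\<lambda>t. \<i> * siegel_rho z * ?L (siegel_dilate (1 + t) z)) = g (siegel_dilate 2 z) - g z"
    using d1 by (simp only: integral_unique one_add_one add_0_right)
  have "cmod (integral {0..1} (\<lambda>t. \<i> * siegel_rho z * ?L (siegel_dilate (1 + t) z))) \<le>
     integral {0..1} (\<lambda>t. siegel_rho z * cmod (?L (siegel_dilate (1 + t) z)))"
    using \<rho> by (intro integral_norm_bound_integral integrable_continuous_interval continuous_intros Ld)
      (auto simp: norm_mult)
  moreover have "cmod (g z) \<le> cmod (g (siegel_dilate 2 z)) + cmod (g (siegel_dilate 2 z) - g z)"
    by (metis norm_minus_commute norm_triangle_sub add.commute)
  ultimately show "cmod (g z) \<le> cmod (g (siegel_dilate 2 z)) +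
      integral {0..1} (\<lambda>t. siegel_rho z * cmod (?L (siegel_dilate (1 + t) z)))"
    unfolding ftc by linarith
qed

text \<open>
  The constant in front of the first term can be made arbitrarily close to 1, on which the absorption
  argument below depends. Either \<open>y\<close> is at most \<open>\<epsilon> x\<close>, or \<open>x\<close> is less than \<open>y / \<epsilon>\<close>.
\<close>

lemma powr_add_le:
  fixes x y \<epsilon> p :: real
  assumes "0 \<le> x" "0 \<le> y" "0 < \<epsilon>" "0 \<le> p"
  shows "(x + y) powr p \<le> (1 + \<epsilon>) powr p * x powr p + (1 + 1 / \<epsilon>) powr p * y powr p"
proof (cases "y \<le> \<epsilon> * x")
  case True
  then have "(x + y) powr p \<le> ((1 + \<epsilon>) * x) powr p"
    using assms by (intro powr_mono2) (auto simp: algebra_simps)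
  also have "\<dots> = (1 + \<epsilon>) powr p * x powr p" using assms by (simp add: powr_mult)
  finally show ?thesis by (simp add: add_increasing2)
next
  case False
  then have "(x + y) powr p \<le> ((1 + 1 / \<epsilon>) * y) powr p"
    using assms by (intro powr_mono2) (auto simp: field_simps)
  also have "\<dots> = (1 + 1 / \<epsilon>) powr p * y powr p" using assms by (simp add: powr_mult)
  finally show ?thesis by (simp add: add_increasing)
qed

text \<open>
  By Tonelli the left-hand side is a mean over \<open>t\<close> of integrals of \<open>g \<circ> \<delta>\<^sub>1\<^sub>+\<^sub>t\<close>, and each of these is at most
  the integral of \<open>g\<close>, since \<open>1 + t \<ge> 1\<close> and the exponent \<open>s + p + 1\<close> of the scaling factor is not
  negative.
\<close>

lemma bergman_integral_increment:
  fixes g :: "complex ^ 'n::{finite,linorder} \<Rightarrow> complex"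
  assumes g: "continuous_on siegel_domain g" and p: "0 < p" and s: "-1 \<le> s + p"
  defines "F \<equiv> \<lambda>z. indicator siegel_domain z * (ennreal (siegel_rho z powr s) *
      (\<integral>\<^sup>+ t. indicator {0..1} t * ennreal ((siegel_rho z * cmod (g (siegel_dilate (1 + t) z))) powr p) \<partial>lborel))"
  shows "F \<in> borel_measurable lborel" "(\<integral>\<^sup>+ z. F z \<partial>lborel) \<le> bergman_integral p (s + p) g"
proof -
  let ?U = "siegel_domain :: (complex, 'n) vec set"
  define G where "G = (\<lambda>z. indicator ?U z * ennreal (cmod (g z) powr p))"
  have G[measurable]: "G \<in> borel_measurable borel"
    unfolding G_def by (rule measurable_indicator_powr[OF g p])
  let ?f = "\<lambda>z t. indicator {0..1::real} t * (G (siegel_dilate (1 + t) z) * ennreal (siegel_rho z powr (s + p)))"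
  have dm: "(\<lambda>x. siegel_dilate (1 + snd x) (fst x) :: (complex, 'n) vec) \<in> borel_measurable (borel :: ((complex, 'n) vec \<times> real) measure)"
    by (intro borel_measurable_continuous_onI continuous_on_siegel_dilate continuous_on_add
        continuous_on_const continuous_on_fst continuous_on_snd continuous_on_id)
  have Gd: "(\<lambda>x. G (siegel_dilate (1 + snd x) (fst x))) \<in> borel_measurable (borel \<Otimes>\<^sub>M borel)"
    using measurable_compose[OF dm G] by (simp add: borel_prod)
  have fm: "(\<lambda>(z, t). ?f z t) \<in> borel_measurable (lborel \<Otimes>\<^sub>M lborel)"
  proof -
    have "(\<lambda>(z, t). ?f z t) \<in> borel_measurable (borel \<Otimes>\<^sub>M borel)"
      unfolding case_prod_unfold using Gd by measurable
    then show ?thesis by simp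
  qed
  have eq: "F = (\<lambda>z. \<integral>\<^sup>+ t. ?f z t \<partial>lborel)"
  proof
    fix z
    show "F z = (\<integral>\<^sup>+ t. ?f z t \<partial>lborel)"
    proof (cases "z \<in> ?U")
      case True
      then have \<rho>: "0 < siegel_rho z" by (simp add: siegel_domain_eq)
      have 1: "indicator {0..1} t * ennreal ((siegel_rho z * cmod (g (siegel_dilate (1 + t) z))) powr p)
         = ennreal (siegel_rho z powr p) * (indicator {0..1} t * G (siegel_dilate (1 + t) z))" for t
        using True \<rho> by (auto simp: G_def siegel_dilate_mem_iff powr_mult ennreal_mult indicator_def)
      have dt: "(\<lambda>t. siegel_dilate (1 + t) z) \<in> borel_measurable borel"
        by (intro borel_measurable_continuous_onI continuous_on_siegel_dilate continuous_on_add
            continuous_on_const continuous_on_id)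
      have tm: "(\<lambda>t. indicator {0..1} t * G (siegel_dilate (1 + t) z)) \<in> borel_measurable lborel"
        using measurable_compose[OF dt G] by simp
      have "F z = ennreal (siegel_rho z powr s) * (ennreal (siegel_rho z powr p) *
          (\<integral>\<^sup>+ t. indicator {0..1} t * G (siegel_dilate (1 + t) z) \<partial>lborel))"
        using True by (simp only: F_def 1 nn_integral_cmult[OF tm]) simp
      also have "\<dots> = ennreal (siegel_rho z powr (s + p)) *
          (\<integral>\<^sup>+ t. indicator {0..1} t * G (siegel_dilate (1 + t) z) \<partial>lborel)"
        by (simp add: powr_add ennreal_mult mult.assoc)
      also have "\<dots> = (\<integral>\<^sup>+ t. ?f z t \<partial>lborel)"
        by (subst nn_integral_cmult[OF tm, symmetric]) (simp add: mult_ac)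
      finally show ?thesis .
    next
      case False
      have "?f z t = 0" for t
        using False by (auto simp: G_def indicator_def siegel_dilate_mem_iff)
      then have "(\<integral>\<^sup>+ t. ?f z t \<partial>lborel) = (\<integral>\<^sup>+ t. 0 \<partial>(lborel :: real measure))"
        by (intro nn_integral_cong)
      then show ?thesis using False by (simp add: F_def)
    qed
  qed
  show "F \<in> borel_measurable lborel"
    unfolding eq by (rule lborel.borel_measurable_nn_integral[OF fm])
  have "(\<integral>\<^sup>+ z. F z \<partial>lborel) = (\<integral>\<^sup>+ t. (\<integral>\<^sup>+ z. ?f z t \<partial>lborel) \<partial>lborel)"
    unfolding eq by (rule lborel_pair.Fubini'[OF fm, symmetric])
  also have "\<dots> \<le> (\<integral>\<^sup>+ t. bergman_integral p (s + p) g * indicator {0..1::real} t \<partial>lborel)"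
  proof (rule nn_integral_mono)
    fix t :: real
    show "(\<integral>\<^sup>+ z. ?f z t \<partial>lborel) \<le> bergman_integral p (s + p) g * indicator {0..1} t"
    proof (cases "t \<in> {0..1}")
      case True
      then have t: "0 < 1 + t" by simp
      have "(\<integral>\<^sup>+ z. ?f z t \<partial>lborel) = bergman_integral p (s + p) (\<lambda>z. g (siegel_dilate (1 + t) z))"
        unfolding bergman_integral_def
        using True t by (intro nn_integral_cong) (auto simp: G_def indicator_def siegel_dilate_mem_iff ennreal_mult)
      also have "\<dots> \<le> ennreal ((1 + t) powr (s + p + 1)) * bergman_integral p (s + p) (\<lambda>z. g (siegel_dilate (1 + t) z))"
      proof -
        have "1 \<le> ennreal ((1 + t) powr (s + p + 1))"
          using True s by (simp add: ge_one_powr_ge_zero)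
        from mult_right_mono[OF this, of "bergman_integral p (s + p) (\<lambda>z. g (siegel_dilate (1 + t) z))"]
        show ?thesis by simp
      qed
      also have "\<dots> = bergman_integral p (s + p) g"
        by (rule bergman_integral_siegel_dilate[OF g p t, symmetric])
      finally show ?thesis using True by simp
    qed simp
  qed
  also have "\<dots> = bergman_integral p (s + p) g"
    by (subst nn_integral_cmult_indicator) auto
  finally show "(\<integral>\<^sup>+ z. F z \<partial>lborel) \<le> bergman_integral p (s + p) g" .
qed

lemma ennreal_absorb:
  assumes "X \<le> ennreal a * X + Y" "X < \<infinity>" "0 \<le> a" "a < 1"
  shows "X \<le> ennreal (1 / (1 - a)) * Y"
proof (cases Y)
  case (real y)
  obtain x where x: "X = ennreal x" "0 \<le> x" using assms(2) by (cases X) auto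
  have "ennreal x \<le> ennreal (a * x + y)"
    using assms real x by (simp add: ennreal_mult ennreal_plus)
  then have "x \<le> a * x + y" using real x assms(3) by (subst (asm) ennreal_le_iff) auto
  then have "x \<le> 1 / (1 - a) * y" using assms by (simp add: field_simps)
  then show ?thesis using real x assms by (simp add: ennreal_mult[symmetric] ennreal_leI)
next
  case top
  then show ?thesis using assms by (simp add: ennreal_mult_top)
qed

text \<open>
  A Hardy inequality along the lines in direction \<open>\<i> e\<^sub>n\<close>, with the boundary condition at infinity replaced
  by the finiteness of the integral of \<open>g\<close>.
\<close>

lemma bergman_integral_le_siegel_L_last:
  assumes p: "1 \<le> p" and s: "-1 < s"
  shows "\<exists>C>0. \<forall>g :: complex ^ 'n::{finite,linorder} \<Rightarrow> complex.
    conj_holomorphic siegel_domain {} g \<longrightarrow> bergman_integral p s g < \<infinity> \<longrightarrow>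
    bergman_integral p s g \<le> ennreal C * bergman_integral p (s + p) (siegel_L last_index g)"
proof -
  \<comment> \<open>This choice gives \<open>A 2\<^sup>-\<^sup>(\<^sup>s\<^sup>+\<^sup>1\<^sup>) = 2\<^sup>-\<^sup>(\<^sup>s\<^sup>+\<^sup>1\<^sup>)\<^sup>/\<^sup>2 < 1\<close> for the constant \<open>A = (1 + \<epsilon>)\<^sup>p\<close>.\<close>
  define \<epsilon> where "\<epsilon> = 2 powr ((s + 1) / (2 * p)) - 1"
  have "1 < (2::real) powr ((s + 1) / (2 * p))" using p s by (intro gr_one_powr) auto
  then have \<epsilon>: "0 < \<epsilon>" by (simp add: \<epsilon>_def)
  define A B where "A = (1 + \<epsilon>) powr p" and "B = (1 + 1 / \<epsilon>) powr p"
  define a where "a = A * 2 powr (- (s + 1))"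
  have A: "A = 2 powr ((s + 1) / 2)" using p by (simp add: A_def \<epsilon>_def powr_powr)
  have "a = 2 powr (- ((s + 1) / 2))" unfolding a_def A powr_add[symmetric]
    by (rule arg_cong[of _ _ "(powr) 2"]) (simp add: field_simps)
  moreover have "(2::real) powr (- ((s + 1) / 2)) < 2 powr 0" using s by (intro powr_less_mono) auto
  ultimately have a: "0 \<le> a" "a < 1" by simp_all
  have aA: "a * 2 powr (s + 1) = A"
    unfolding a_def mult.assoc powr_add[symmetric] by simp
  have B0: "0 < B" using add_pos_pos[of 1 "1 / \<epsilon>"] \<epsilon> unfolding B_def powr_gt_zero by auto
  show ?thesis
  proof (intro exI[of _ "B / (1 - a)"] conjI allI impI)
    show "0 < B / (1 - a)" using B0 a by simp
    fix g :: "(complex, 'n) vec \<Rightarrow> complex"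
    assume g: "conj_holomorphic siegel_domain {} g" and fin: "bergman_integral p s g < \<infinity>"
    let ?U = "siegel_domain :: (complex, 'n) vec set"
    let ?L = "siegel_L last_index g"
    define I where "I = (\<lambda>z. \<integral>\<^sup>+ t. indicator {0..1} t * ennreal ((siegel_rho z * cmod (?L (siegel_dilate (1 + t) z))) powr p) \<partial>lborel)"
    have gc: "continuous_on ?U g" by (rule conj_holomorphic_continuous_on[OF open_siegel_domain g])
    have Lc: "continuous_on ?U ?L"
      by (rule conj_holomorphic_continuous_on[OF open_siegel_domain conj_holomorphic_siegel_L[OF open_siegel_domain g]]) simp
    have gdc: "continuous_on ?U (\<lambda>z. g (siegel_dilate 2 z))"
      by (rule continuous_on_compose2[OF gc continuous_on_siegel_dilate[OF continuous_on_const continuous_on_id]]) (auto simp: siegel_dilate_mem_iff)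
    have p0: "0 < p" using p by simp
    have "-1 \<le> s + p" using p s by simp
    note incr = bergman_integral_increment[OF Lc p0 this]
    have m1: "(\<lambda>z. ennreal A * (indicator ?U z * ennreal (cmod (g (siegel_dilate 2 z)) powr p * siegel_rho z powr s))) \<in> borel_measurable lborel"
      using measurable_bergman_integrand[OF gdc p0] by measurable
    have "bergman_integral p s g \<le> (\<integral>\<^sup>+ z. ennreal A * (indicator ?U z * ennreal (cmod (g (siegel_dilate 2 z)) powr p * siegel_rho z powr s))
       + ennreal B * (indicator ?U z * (ennreal (siegel_rho z powr s) * I z)) \<partial>lborel)"
      unfolding bergman_integral_def
    proof (rule nn_integral_mono)
      fix z :: "(complex, 'n) vec"
      show "indicator ?U z * ennreal (cmod (g z) powr p * siegel_rho z powr s) \<le>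
        ennreal A * (indicator ?U z * ennreal (cmod (g (siegel_dilate 2 z)) powr p * siegel_rho z powr s))
        + ennreal B * (indicator ?U z * (ennreal (siegel_rho z powr s) * I z))"
      proof (cases "z \<in> ?U")
        case True
        then have \<rho>: "0 < siegel_rho z" by (simp add: siegel_domain_eq)
        let ?h = "\<lambda>t. siegel_rho z * cmod (?L (siegel_dilate (1 + t) z))"
        note inc = siegel_dilate_increment[OF g True]
        have h0: "0 \<le> integral {0..1} ?h"
          using \<rho> by (intro integral_nonneg integrable_continuous_interval inc(1)) auto
        have "cmod (g z) powr p \<le> (cmod (g (siegel_dilate 2 z)) + integral {0..1} ?h) powr p"
          using p inc(2) by (intro powr_mono2) auto
        also have "\<dots> \<le> A * cmod (g (siegel_dilate 2 z)) powr p + B * integral {0..1} ?h powr p"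
          unfolding A_def B_def using h0 \<epsilon> p by (intro powr_add_le) auto
        finally have "cmod (g z) powr p * siegel_rho z powr s \<le>
           (A * cmod (g (siegel_dilate 2 z)) powr p + B * integral {0..1} ?h powr p) * siegel_rho z powr s"
          by (rule mult_right_mono) simp
        then have "ennreal (cmod (g z) powr p * siegel_rho z powr s) \<le>
            ennreal A * ennreal (cmod (g (siegel_dilate 2 z)) powr p * siegel_rho z powr s) +
            ennreal B * (ennreal (siegel_rho z powr s) * ennreal (integral {0..1} ?h powr p))"
          using B0 by (simp add: ennreal_mult[symmetric] ennreal_plus[symmetric] A_def algebra_simps
              del: ennreal_plus)
        also have "\<dots> \<le> ennreal A * ennreal (cmod (g (siegel_dilate 2 z)) powr p * siegel_rho z powr s) +
            ennreal B * (ennreal (siegel_rho z powr s) * I z)"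
          unfolding I_def using \<rho>
          by (intro add_left_mono mult_left_mono nn_integral_powr_Jensen p inc(1)) auto
        finally show ?thesis using True by simp
      qed simp
    qed
    also have "\<dots> = (\<integral>\<^sup>+ z. ennreal A * (indicator ?U z * ennreal (cmod (g (siegel_dilate 2 z)) powr p * siegel_rho z powr s)) \<partial>lborel)
       + (\<integral>\<^sup>+ z. ennreal B * (indicator ?U z * (ennreal (siegel_rho z powr s) * I z)) \<partial>lborel)"
      by (rule nn_integral_add[OF m1]) (use incr(1) in \<open>simp add: I_def\<close>)
    also have "(\<integral>\<^sup>+ z. ennreal A * (indicator ?U z * ennreal (cmod (g (siegel_dilate 2 z)) powr p * siegel_rho z powr s)) \<partial>lborel)
       = ennreal A * bergman_integral p s (\<lambda>z. g (siegel_dilate 2 z))"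
      unfolding bergman_integral_def
      by (rule nn_integral_cmult) (use measurable_bergman_integrand[OF gdc p0] in simp)
    also have "\<dots> = ennreal a * (ennreal (2 powr (s + 1)) * bergman_integral p s (\<lambda>z. g (siegel_dilate 2 z)))"
      by (subst aA[symmetric], subst ennreal_mult'[OF a(1)]) (simp only: mult.assoc)
    also have "ennreal (2 powr (s + 1)) * bergman_integral p s (\<lambda>z. g (siegel_dilate 2 z)) = bergman_integral p s g"
      by (rule bergman_integral_siegel_dilate[OF gc p0, symmetric]) simp
    also have "(\<integral>\<^sup>+ z. ennreal B * (indicator ?U z * (ennreal (siegel_rho z powr s) * I z)) \<partial>lborel)
       = ennreal B * (\<integral>\<^sup>+ z. indicator ?U z * (ennreal (siegel_rho z powr s) * I z) \<partial>lborel)"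
      by (rule nn_integral_cmult) (use incr(1) in \<open>simp add: I_def\<close>)
    also have "ennreal a * bergman_integral p s g +
        ennreal B * (\<integral>\<^sup>+ z. indicator ?U z * (ennreal (siegel_rho z powr s) * I z) \<partial>lborel)
       \<le> ennreal a * bergman_integral p s g + ennreal B * bergman_integral p (s + p) ?L"
      using incr(2) by (intro add_left_mono mult_left_mono) (simp_all add: I_def)
    finally have "bergman_integral p s g \<le> ennreal (1 / (1 - a)) * (ennreal B * bergman_integral p (s + p) ?L)"
      by (rule ennreal_absorb[OF _ fin a])
    then show "bergman_integral p s g \<le> ennreal (B / (1 - a)) * bergman_integral p (s + p) ?L"
      using a B0 by (simp add: mult.assoc[symmetric] ennreal_mult[symmetric])
  qed
qed

lemma bergman_integral_le_siegel_L_last_power: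
  assumes p: "1 \<le> p" and t: "-1 < t"
  shows "\<exists>C>0. \<forall>f :: complex ^ 'n::{finite,linorder} \<Rightarrow> complex.
    conj_holomorphic siegel_domain {} f \<longrightarrow> bergman_integral p t f < \<infinity> \<longrightarrow>
    bergman_integral p t f \<le> ennreal C * bergman_integral p (t + p * N) ((siegel_L last_index ^^ N) f)"
proof (induction N)
  case 0
  show ?case by (intro exI[of _ 1]) simp
next
  case (Suc N)
  then obtain C where C: "C > 0" "\<And>f :: (complex, 'n) vec \<Rightarrow> complex.
    conj_holomorphic siegel_domain {} f \<Longrightarrow> bergman_integral p t f < \<infinity> \<Longrightarrow>
    bergman_integral p t f \<le> ennreal C * bergman_integral p (t + p * N) ((siegel_L last_index ^^ N) f)"
    by blast
  have "-1 < t + p * N" using p t mult_nonneg_nonneg[of p "real N"] by linarith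
  from bergman_integral_le_siegel_L_last[OF p this]
  obtain C' where C': "C' > 0" "\<And>g :: (complex, 'n) vec \<Rightarrow> complex.
    conj_holomorphic siegel_domain {} g \<Longrightarrow> bergman_integral p (t + p * N) g < \<infinity> \<Longrightarrow>
    bergman_integral p (t + p * N) g \<le> ennreal C' * bergman_integral p (t + p * N + p) (siegel_L last_index g)"
    by blast
  show ?case
  proof (intro exI[of _ "C * C'"] conjI allI impI)
    show "0 < C * C'" using C C' by simp
    fix f :: "(complex, 'n) vec \<Rightarrow> complex"
    assume f: "conj_holomorphic siegel_domain {} f" and fin: "bergman_integral p t f < \<infinity>"
    let ?g = "(siegel_L last_index ^^ N) f"
    have g: "conj_holomorphic siegel_domain {} ?g"
      by (rule conj_holomorphic_siegel_L_power[OF open_siegel_domain f]) simp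
    have "bergman_integral p (t + p * N) ?g \<le>
      ennreal (4 * ((4 ^ N * fact N) powr p * 2 powr \<bar>t - tangent_order (last_index :: 'n)\<bar>)) * bergman_integral p t f"
      using siegel_L_power_integral_bound[OF p f, of last_index t N] by (simp add: tangent_order_def)
    also have "\<dots> < \<infinity>" using fin by (simp add: ennreal_mult_less_top)
    finally have gfin: "bergman_integral p (t + p * N) ?g < \<infinity>" .
    have "bergman_integral p t f \<le> ennreal C * bergman_integral p (t + p * N) ?g"
      by (rule C(2)[OF f fin])
    also have "\<dots> \<le> ennreal C * (ennreal C' * bergman_integral p (t + p * N + p) (siegel_L last_index ?g))"
      by (intro mult_left_mono C'(2) g gfin) simp
    finally show "bergman_integral p t f \<le> ennreal (C * C') * bergman_integral p (t + p * Suc N) ((siegel_L last_index ^^ Suc N) f)"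
      using C C' by (simp add: ennreal_mult mult.assoc algebra_simps)
  qed
qed

section \<open>Comparison of the norms\<close>

text \<open>
  The operators in the list are applied from right to left, and as the list is distinct, each new index
  lies outside the set of indices whose conjugates occur already. Applying \<open>\<L>\<^sub>n\<close> introduces no conjugate,
  which is why the last index can be left out of that set.
\<close>

lemma foldr_siegel_L_integral_bound:
  fixes \<alpha> :: "'n::{finite,linorder} \<Rightarrow> nat"
  assumes p: "1 \<le> p" and xs: "distinct xs"
  shows "\<exists>C>0. \<forall>f :: complex ^ 'n::{finite,linorder} \<Rightarrow> complex. conj_holomorphic siegel_domain {} f \<longrightarrow>
    conj_holomorphic siegel_domain (set xs - {last_index}) (foldr (\<lambda>j. siegel_L j ^^ \<alpha> j) xs f) \<and>
    bergman_integral p (t + p * (\<Sum>j\<in>set xs. tangent_order j * \<alpha> j)) (foldr (\<lambda>j. siegel_L j ^^ \<alpha> j) xs f)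
      \<le> ennreal C * bergman_integral p t f"
  using xs
proof (induction xs)
  case Nil
  show ?case by (intro exI[of _ 1]) simp
next
  case (Cons x xs)
  define D where "D = (\<lambda>f :: (complex, 'n) vec \<Rightarrow> complex. foldr (\<lambda>j. siegel_L j ^^ \<alpha> j) xs f)"
  define s where "s = t + p * (\<Sum>j\<in>set xs. tangent_order j * \<alpha> j)"
  obtain C where C: "C > 0" "\<And>f. conj_holomorphic siegel_domain {} f \<Longrightarrow>
    conj_holomorphic siegel_domain (set xs - {last_index}) (D f)"
    "\<And>f. conj_holomorphic siegel_domain {} f \<Longrightarrow>
    bergman_integral p s (D f) \<le> ennreal C * bergman_integral p t f"
    using Cons unfolding D_def s_def by auto
  define C' where "C' = 4 * ((4 ^ \<alpha> x * fact (\<alpha> x)) powr p * 2 powr \<bar>s - tangent_order x\<bar>)"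
  have C': "0 < C'" by (simp add: C'_def)
  have ord: "t + p * (\<Sum>j\<in>set (x # xs). tangent_order j * \<alpha> j) = s + p * (tangent_order x * \<alpha> x)"
    using Cons.prems by (simp add: s_def algebra_simps)
  show ?case
  proof (intro exI[of _ "C' * C"] conjI allI impI)
    show "0 < C' * C" using C C' by simp
    fix f :: "(complex, 'n) vec \<Rightarrow> complex"
    assume f: "conj_holomorphic siegel_domain {} f"
    have "conj_holomorphic siegel_domain (set (x # xs) - {last_index}) (D f)"
      by (rule conj_holomorphic_mono[OF C(2)[OF f]]) auto
    from conj_holomorphic_siegel_L_power[OF open_siegel_domain this, of x]
    show "conj_holomorphic siegel_domain (set (x # xs) - {last_index}) (foldr (\<lambda>j. siegel_L j ^^ \<alpha> j) (x # xs) f)"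
      by (auto simp: D_def)
    have "bergman_integral p (s + p * (tangent_order x * \<alpha> x)) ((siegel_L x ^^ \<alpha> x) (D f)) \<le>
       ennreal C' * bergman_integral p s (D f)"
      unfolding C'_def
      by (rule siegel_L_power_integral_bound[OF p C(2)[OF f]]) (use Cons.prems in auto)
    also have "\<dots> \<le> ennreal C' * (ennreal C * bergman_integral p t f)"
      by (intro mult_left_mono C(3) f) simp
    finally show "bergman_integral p (t + p * (\<Sum>j\<in>set (x # xs). tangent_order j * \<alpha> j))
        (foldr (\<lambda>j. siegel_L j ^^ \<alpha> j) (x # xs) f) \<le> ennreal (C' * C) * bergman_integral p t f"
      unfolding ord using C C' by (simp add: D_def ennreal_mult mult.assoc)
  qed
qed

lemma multi_weight_eq:
  fixes \<alpha> :: "'n::{finite,linorder} \<Rightarrow> nat"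
  shows "(\<Sum>j\<in>UNIV. tangent_order j * \<alpha> j) = multi_weight \<alpha>"
proof -
  have "(\<Sum>j\<in>UNIV. tangent_order j * \<alpha> j) =
     tangent_order (last_index :: 'n) * \<alpha> last_index + (\<Sum>j\<in>UNIV - {last_index}. tangent_order j * \<alpha> j)"
    by (subst sum.remove[of UNIV last_index]) auto
  also have "(\<Sum>j\<in>UNIV - {last_index}. tangent_order j * \<alpha> j) = (\<Sum>j\<in>UNIV - {last_index}. \<alpha> j / 2)"
    by (intro sum.cong) (auto simp: tangent_order_def)
  finally show ?thesis
    by (simp add: multi_weight_def tangent_order_def sum_divide_distrib)
qed

lemma siegel_L_multi_integral_bound:
  assumes p: "1 \<le> p"
  shows "\<exists>C>0. \<forall>f :: complex ^ 'n::{finite,linorder} \<Rightarrow> complex. conj_holomorphic siegel_domain {} f \<longrightarrow>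
    bergman_integral p (t + p * multi_weight \<alpha>) (siegel_L_multi \<alpha> f) \<le> ennreal C * bergman_integral p t f"
  using foldr_siegel_L_integral_bound[where xs = "sorted_list_of_set (UNIV :: 'n set)" and t = t and \<alpha> = \<alpha>, OF p]
  unfolding siegel_L_multi_def by (simp add: multi_weight_eq) blast

definition ennreal_root :: "real \<Rightarrow> ennreal \<Rightarrow> ennreal" where
  "ennreal_root p I = (if I = \<infinity> then \<infinity> else ennreal (enn2real I powr (1 / p)))"

lemma ennreal_root_mono:
  assumes "I \<le> ennreal C * J" "0 < C" "1 \<le> p"
  shows "ennreal_root p I \<le> ennreal (C powr (1 / p)) * ennreal_root p J"
proof (cases "J = \<infinity>")
  case True
  then show ?thesis using assms by (simp add: ennreal_root_def ennreal_mult_top)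
next
  case False
  then obtain y where y: "J = ennreal y" "0 \<le> y" by (cases J) auto
  then obtain x where x: "I = ennreal x" "0 \<le> x"
    using assms by (cases I) (auto simp: ennreal_mult[symmetric] top_unique)
  have "ennreal x \<le> ennreal (C * y)" using assms x y by (simp add: ennreal_mult)
  then have "x \<le> C * y" using assms y by (subst (asm) ennreal_le_iff) auto
  then have "x powr (1 / p) \<le> (C * y) powr (1 / p)" using assms x by (intro powr_mono2) auto
  also have "\<dots> = C powr (1 / p) * y powr (1 / p)" using assms y by (simp add: powr_mult)
  finally show ?thesis using x y
    by (simp add: ennreal_root_def ennreal_mult[symmetric] ennreal_leI)
qed

lemma siegel_norm_eq: "siegel_norm p t f = ennreal_root p (bergman_integral p t f)"
proof -
  have "(\<integral>\<^sup>+ z. ennreal (cmod (f z) powr p * siegel_rho z powr t) \<partial>lebesgue_on siegel_domain) = bergman_integral p t f"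
    unfolding bergman_integral_def
    by (subst nn_integral_restrict_space)
      (auto simp: nn_integral_completion mult.commute intro!: sets_completionI_sets borel_open open_siegel_domain)
  then show ?thesis by (simp add: siegel_norm_def ennreal_root_def Let_def)
qed

lemma siegel_norm_weight:
  assumes "0 < p" "\<And>z. 0 < siegel_rho z \<Longrightarrow> c z = siegel_rho z powr k"
  shows "siegel_norm p t (\<lambda>z. complex_of_real (c z) * g z) = ennreal_root p (bergman_integral p (t + p * k) g)"
proof -
  have "bergman_integral p t (\<lambda>z. complex_of_real (c z) * g z) = bergman_integral p (t + p * k) g"
    unfolding bergman_integral_def
  proof (rule nn_integral_cong)
    fix z :: "(complex, 'a) vec"
    show "indicator siegel_domain z * ennreal (cmod (complex_of_real (c z) * g z) powr p * siegel_rho z powr t) =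
      indicator siegel_domain z * ennreal (cmod (g z) powr p * siegel_rho z powr (t + p * k))"
    proof (cases "z \<in> siegel_domain")
      case True
      then have \<rho>: "0 < siegel_rho z" by (simp add: siegel_domain_eq)
      have "cmod (complex_of_real (c z) * g z) powr p = siegel_rho z powr (p * k) * cmod (g z) powr p"
        using assms(2)[OF \<rho>] by (simp add: norm_mult powr_mult powr_powr mult.commute)
      then show ?thesis by (simp add: powr_add mult_ac)
    qed simp
  qed
  then show ?thesis by (simp add: siegel_norm_eq)
qed

lemma siegel_L_multi_last:
  "siegel_L_multi (\<lambda>j. if j = last_index then N else 0) f = (siegel_L last_index ^^ N) f"
proof -
  have "foldr (\<lambda>j. siegel_L j ^^ (if j = last_index then N else 0)) xs f =
      (if last_index \<in> set xs then (siegel_L last_index ^^ N) f else f)" if "distinct xs" for xs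
    using that by (induction xs) auto
  from this[of "sorted_list_of_set UNIV"] show ?thesis
    by (simp add: siegel_L_multi_def)
qed

theorem theorem1p4:
  fixes p t :: real and N :: nat
  assumes "1 \<le> p" and "t > -1"
  shows "let A = (siegel_bergman p t :: (complex ^ 'n::{finite,linorder} \<Rightarrow> complex) set);
             F = (\<lambda>f. siegel_norm p t f);
             G = (\<lambda>f. siegel_norm p t
                   (\<lambda>z. complex_of_real (siegel_rho z ^ N) * (siegel_L last_index ^^ N) f z));
             H = (\<lambda>f. \<Sum>\<alpha> | multi_order \<alpha> = N. siegel_norm p t
                   (\<lambda>z. complex_of_real (siegel_rho z powr multi_weight \<alpha>) * siegel_L_multi \<alpha> f z))
         in comparable_on A F G \<and> comparable_on A G H \<and> comparable_on A F H"
proof -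
  define A where "A = (siegel_bergman p t :: ((complex, 'n) vec \<Rightarrow> complex) set)"
  define F where "F = (\<lambda>f :: (complex, 'n) vec \<Rightarrow> complex. siegel_norm p t f)"
  define G where "G = (\<lambda>f :: (complex, 'n) vec \<Rightarrow> complex. siegel_norm p t
                   (\<lambda>z. complex_of_real (siegel_rho z ^ N) * (siegel_L last_index ^^ N) f z))"
  define T where "T = (\<lambda>\<alpha> (f :: (complex, 'n) vec \<Rightarrow> complex). siegel_norm p t
                   (\<lambda>z. complex_of_real (siegel_rho z powr multi_weight \<alpha>) * siegel_L_multi \<alpha> f z))"
  define H where "H = (\<lambda>f. \<Sum>\<alpha> | multi_order \<alpha> = N. T \<alpha> f)"
  have p0: "0 < p" using assms by simp
  have F_eq: "F f = ennreal_root p (bergman_integral p t f)" for f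
    by (simp add: F_def siegel_norm_eq)
  have G_eq: "G f = ennreal_root p (bergman_integral p (t + p * N) ((siegel_L last_index ^^ N) f))" for f
    unfolding G_def by (rule siegel_norm_weight[OF p0]) (simp add: powr_realpow)
  have T_eq: "T \<alpha> f = ennreal_root p (bergman_integral p (t + p * multi_weight \<alpha>) (siegel_L_multi \<alpha> f))" for \<alpha> f
    unfolding T_def by (rule siegel_norm_weight[OF p0]) simp
  have A: "conj_holomorphic siegel_domain {} f" "bergman_integral p t f < \<infinity>" if "f \<in> A" for f
    using that conj_holomorphic.holomorphic
    by (auto simp: A_def siegel_bergman_def siegel_Lp_def siegel_norm_eq ennreal_root_def
        less_top[symmetric] split: if_splits)
  obtain C1 where C1: "C1 > 0" "\<And>f. f \<in> A \<Longrightarrow> F f \<le> ennreal C1 * G f"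
  proof -
    obtain C where "C > 0" "\<And>f :: (complex, 'n) vec \<Rightarrow> complex.
      conj_holomorphic siegel_domain {} f \<Longrightarrow> bergman_integral p t f < \<infinity> \<Longrightarrow>
      bergman_integral p t f \<le> ennreal C * bergman_integral p (t + p * N) ((siegel_L last_index ^^ N) f)"
      using bergman_integral_le_siegel_L_last_power[OF assms, of N] by blast
    then show ?thesis
      using that[of "C powr (1 / p)"] A assms by (auto simp: F_eq G_eq intro!: ennreal_root_mono)
  qed
  have "\<exists>C>0. \<forall>f\<in>A. T \<alpha> f \<le> ennreal C * F f" for \<alpha>
  proof -
    obtain C where "C > 0" "\<And>f :: (complex, 'n) vec \<Rightarrow> complex. conj_holomorphic siegel_domain {} f \<Longrightarrow>
      bergman_integral p (t + p * multi_weight \<alpha>) (siegel_L_multi \<alpha> f) \<le> ennreal C * bergman_integral p t f"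
      using siegel_L_multi_integral_bound[OF assms(1), of t \<alpha>] by blast
    then show ?thesis using A assms
      by (intro exI[of _ "C powr (1 / p)"]) (auto simp: F_eq T_eq intro!: ennreal_root_mono)
  qed
  then obtain K where K: "\<And>\<alpha>. K \<alpha> > 0" "\<And>\<alpha> f. f \<in> A \<Longrightarrow> T \<alpha> f \<le> ennreal (K \<alpha>) * F f"
    by metis
  define C2 where "C2 = 1 + (\<Sum>\<alpha> | multi_order \<alpha> = N. K \<alpha>)"
  have K0: "0 \<le> (\<Sum>\<alpha> | multi_order \<alpha> = N. K \<alpha>)" by (intro sum_nonneg less_imp_le K)
  have C2: "C2 > 0" "H f \<le> ennreal C2 * F f" if "f \<in> A" for f
  proof -
    show "C2 > 0" using K0 by (simp add: C2_def)
    have "H f \<le> (\<Sum>\<alpha> | multi_order \<alpha> = N. ennreal (K \<alpha>) * F f)"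
      unfolding H_def by (intro sum_mono K that)
    also have "\<dots> = ennreal (\<Sum>\<alpha> | multi_order \<alpha> = N. K \<alpha>) * F f"
      using K(1) by (simp add: sum_distrib_right[symmetric] sum_ennreal less_imp_le)
    also have "\<dots> \<le> ennreal C2 * F f"
      using K0 by (intro mult_right_mono ennreal_leI) (auto simp: C2_def)
    finally show "H f \<le> ennreal C2 * F f" .
  qed
  have C2pos: "C2 > 0" using K0 by (simp add: C2_def)
  have GH: "G f \<le> H f" for f
  proof -
    let ?\<alpha> = "\<lambda>j :: 'n. if j = last_index then N else 0"
    have w: "multi_weight ?\<alpha> = N" "multi_order ?\<alpha> = N"
      by (simp_all add: multi_weight_def multi_order_def)
    have "G f = T ?\<alpha> f" unfolding G_eq T_eq siegel_L_multi_last w(1) ..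
    also have "\<dots> \<le> H f"
      unfolding H_def using w(2) by (intro member_le_sum finite_multi_order_eq) auto
    finally show ?thesis .
  qed
  have "comparable_on A F G"
    unfolding comparable_on_def
  proof (rule exI[of _ C2], rule exI[of _ C1], intro conjI ballI)
    fix f assume f: "f \<in> A"
    show "F f \<le> ennreal C1 * G f" by (rule C1(2)[OF f])
    show "G f \<le> ennreal C2 * F f" by (rule order_trans[OF GH C2(2)[OF f]])
  qed (use C1(1) C2pos in auto)
  moreover have "comparable_on A G H"
    unfolding comparable_on_def
  proof (rule exI[of _ "C2 * C1"], rule exI[of _ 1], intro conjI ballI)
    fix f assume f: "f \<in> A"
    show "G f \<le> ennreal 1 * H f" using GH by simp
    have "H f \<le> ennreal C2 * F f" by (rule C2(2)[OF f])
    also have "\<dots> \<le> ennreal C2 * (ennreal C1 * G f)" by (intro mult_left_mono C1(2) f) simp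
    finally show "H f \<le> ennreal (C2 * C1) * G f" using C1(1) C2pos by (simp add: ennreal_mult mult.assoc)
  qed (use C1(1) C2pos in auto)
  moreover have "comparable_on A F H"
    unfolding comparable_on_def
  proof (rule exI[of _ C2], rule exI[of _ C1], intro conjI ballI)
    fix f assume f: "f \<in> A"
    have "F f \<le> ennreal C1 * G f" by (rule C1(2)[OF f])
    also have "\<dots> \<le> ennreal C1 * H f" by (intro mult_left_mono GH) simp
    finally show "F f \<le> ennreal C1 * H f" .
    show "H f \<le> ennreal C2 * F f" by (rule C2(2)[OF f])
  qed (use C1(1) C2pos in auto)
  ultimately show ?thesis
    unfolding Let_def A_def F_def G_def H_def T_def by simp
qed

end
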